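(* Let $k\ge 1$ and $n\ge k$ be integers, let $g\in \mathsf{S}_n$ be a permutation having exactly $k$ orbits on $\{1,2,\ldots,n\}$ (equivalently, $g$ decomposes into exactly $k$ disjoint cycles, where $1$-cycles are included), and let $\chi$ be an irreducible complex character of $\mathsf{S}_n$. Then $$|\chi(g)|\le k!.$$
   Context: $\mathsf{S}_n$ denotes the symmetric group on $\{1,\ldots,n\}$. Orbits of $g$ means orbits of the cyclic group $\langle g\rangle$; fixed points count as orbits of size $1$. *)

theory Defs
  imports
    "HOL-Algebra.Sym_Groups"
    "HOL-Algebra.Group_Action"
    "HOL-Algebra.Generated_Groups"
    "Jordan_Normal_Form.VS_Connect"
begin

definition GL_complex :: "nat \<Rightarrow> complex mat monoid" where
  "GL_complex d = units_of (ring_mat TYPE(complex) d ())"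

definition mat_trace :: "complex mat \<Rightarrow> complex" where
  "mat_trace A = (\<Sum>i<dim_row A. A $$ (i, i))"

definition representation :: "('g, 'm) monoid_scheme \<Rightarrow> nat \<Rightarrow> ('g \<Rightarrow> complex mat) \<Rightarrow> bool" where
  "representation G d \<rho> \<longleftrightarrow> group G \<and> \<rho> \<in> hom G (GL_complex d)"

definition invariant_subspace ::
    "('g, 'm) monoid_scheme \<Rightarrow> nat \<Rightarrow> ('g \<Rightarrow> complex mat) \<Rightarrow> complex vec set \<Rightarrow> bool" where
  "invariant_subspace G d \<rho> W \<longleftrightarrow>
     VectorSpace.subspace class_ring W (module_vec TYPE(complex) d) \<and>
     (\<forall>x\<in>carrier G. \<forall>w\<in>W. \<rho> x *\<^sub>v w \<in> W)"

text \<open>The zero representation (degree \<open>0\<close>) is not irreducible.\<close>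

definition irreducible_representation ::
    "('g, 'm) monoid_scheme \<Rightarrow> nat \<Rightarrow> ('g \<Rightarrow> complex mat) \<Rightarrow> bool" where
  "irreducible_representation G d \<rho> \<longleftrightarrow>
     representation G d \<rho> \<and> d > 0 \<and>
     (\<forall>W. invariant_subspace G d \<rho> W \<longrightarrow> W = {0\<^sub>v d} \<or> W = carrier_vec d)"

text \<open>Only the values of a character on the carrier of the group are relevant.\<close>

definition irreducible_character :: "('g, 'm) monoid_scheme \<Rightarrow> ('g \<Rightarrow> complex) \<Rightarrow> bool" where
  "irreducible_character G \<chi> \<longleftrightarrow>
     (\<exists>d \<rho>. irreducible_representation G d \<rho> \<and> (\<forall>x\<in>carrier G. \<chi> x = mat_trace (\<rho> x)))"

text \<open>The orbits on \<open>{1..n}\<close> of the cyclic subgroup generated by \<open>g\<close>; the action of the symmetric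
  group on points is application, hence the identity map in the last argument.\<close>

definition cyclic_orbits :: "nat \<Rightarrow> (nat \<Rightarrow> nat) \<Rightarrow> nat set set" where
  "cyclic_orbits n g =
     Group_Action.orbits ((sym_group n)\<lparr>carrier := generate (sym_group n) {g}\<rparr>) {1..n} (\<lambda>\<sigma>. \<sigma>)"

end

theory Submission
  imports
    Defs
    "HOL-Algebra.Multiplicative_Group"
    "HOL-Combinatorics.Orbits"
    "Jordan_Normal_Form.Schur_Decomposition"
    "Jordan_Normal_Form.Spectral_Radius"
begin

text \<open>
  Following Frobenius, let \<open>a\<^sub>\<delta>\<close> be the Vandermonde alternant in \<open>n\<close> variables, \<open>p\<^sub>\<mu>\<close> the power sum
  of the cycle type \<open>\<mu>\<close> of \<open>g\<close>, and \<open>f\<^sub>\<beta>(g)\<close> the coefficient of \<open>x\<^sup>\<beta>\<close> in \<open>a\<^sub>\<delta> p\<^sub>\<mu>\<close>.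

  Multiplying by one power sum at a time gives the Murnaghan--Nakayama recursion. If the longest
  cycle has length \<open>m\<close>, the nonvanishing terms are the beads of \<open>\<beta>\<close> that can be moved down by \<open>m\<close>;
  moving all of them at once still gives distinct nonnegative beads, so there are at most \<open>n / m \<le> k\<close>
  of them, and \<open>\<bar>f\<^sub>\<beta>(g)\<bar> \<le> k!\<close> follows by induction.

  Multiplication by the \<open>m\<close>-th power sum and its adjoint satisfy a Heisenberg commutation relation in
  degrees at most \<open>n\<close>, which yields column orthogonality: the sum of \<open>f\<^sub>\<beta>(g) f\<^sub>\<beta>(h)\<close> over \<open>\<beta>\<close> is \<open>n!\<close> times
  the number of \<open>x\<close> with \<open>x g = h x\<close>. For an irreducible character \<open>\<chi>\<close> put \<open>z\<^sub>\<beta> = \<langle>\<chi>, f\<^sub>\<beta>\<rangle>\<close>, an integer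
  because \<open>f\<^sub>\<beta>\<close> is an integral combination of permutation characters on cosets of Young subgroups.
  Then \<open>n! \<chi>(h)\<close> is the sum of \<open>z\<^sub>\<beta> f\<^sub>\<beta>(h)\<close>, and \<open>z\<^sub>\<beta>\<^sup>2\<close> sums to \<open>n!\<close>; since \<open>\<bar>z\<^sub>\<beta>\<bar> \<le> z\<^sub>\<beta>\<^sup>2\<close>, this gives
  \<open>\<bar>\<chi>(h)\<bar> \<le> k!\<close> without identifying \<open>\<chi>\<close> with any \<open>f\<^sub>\<beta>\<close>.
\<close>

section \<open>Coefficients of alternants times power sums\<close>

text \<open>\<open>alternant N \<beta>\<close> is the coefficient of \<open>x\<^sup>\<beta>\<close> in the Vandermonde alternant, and \<open>frob N s S \<beta>\<close> its
  coefficient in the alternant times the product of the power sums of degrees \<open>s x\<close>, \<open>x \<in> S\<close>, expanded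
  over the choices \<open>c\<close> of one variable per factor. Only the entries \<open>\<beta> i\<close> with \<open>i < N\<close> matter.\<close>

definition alternant :: "nat \<Rightarrow> (nat \<Rightarrow> int) \<Rightarrow> int" where
  "alternant N \<beta> = (\<Sum>w | w permutes {..<N}. if \<forall>i<N. \<beta> i = int (w i) then sign w else 0)"

definition colour_content :: "('o \<Rightarrow> nat) \<Rightarrow> 'o set \<Rightarrow> ('o \<Rightarrow> nat) \<Rightarrow> nat \<Rightarrow> nat" where
  "colour_content s S c i = (\<Sum>x | x \<in> S \<and> c x = i. s x)"

definition frob :: "nat \<Rightarrow> ('o \<Rightarrow> nat) \<Rightarrow> 'o set \<Rightarrow> (nat \<Rightarrow> int) \<Rightarrow> int" where
  "frob N s S \<beta> = (\<Sum>c\<in>S \<rightarrow>\<^sub>E {..<N}. alternant N (\<lambda>i. \<beta> i - int (colour_content s S c i)))"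

text \<open>Moves bead \<open>i\<close> by \<open>m\<close>. Reading coefficients at
  \<open>bump \<beta> i (- m)\<close> amounts to multiplying by the monomial \<open>x_i^m\<close>,
  so a power sum becomes a sum of bumps.\<close>

definition bump :: "(nat \<Rightarrow> int) \<Rightarrow> nat \<Rightarrow> int \<Rightarrow> nat \<Rightarrow> int" where
  "bump \<beta> i m = \<beta>(i := \<beta> i + m)"

text \<open>The coefficient form of a skew-symmetric polynomial in \<open>N\<close>
  variables.\<close>

definition alternating :: "nat \<Rightarrow> ((nat \<Rightarrow> int) \<Rightarrow> int) \<Rightarrow> bool" where
  "alternating N \<phi> \<longleftrightarrow>
    (\<forall>\<beta> i j. i < N \<longrightarrow> j < N \<longrightarrow> i \<noteq> j \<longrightarrow> \<phi> (\<beta> \<circ> Transposition.transpose i j) = - \<phi> \<beta>)"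

lemma bump_commute: "bump (bump \<beta> i a) j b = bump (bump \<beta> j b) i a"
  by (auto simp: bump_def fun_eq_iff)

lemma bump_bump [simp]: "bump (bump \<beta> i a) i b = bump \<beta> i (a + b)"
  by (simp add: bump_def add.assoc)

lemma bump_0 [simp]: "bump \<beta> i 0 = \<beta>"
  by (simp add: bump_def)

lemma bump_same [simp]: "bump \<beta> i a i = \<beta> i + a"
  by (simp add: bump_def)

lemma bump_other [simp]: "j \<noteq> i \<Longrightarrow> bump \<beta> i a j = \<beta> j"
  by (simp add: bump_def)

lemma sum_bump: "i < N \<Longrightarrow> (\<Sum>j<N. bump \<beta> i a j) = (\<Sum>j<N. \<beta> j) + a"
  by (subst (1 2) sum.remove[of _ i]) (auto simp: bump_def)

section \<open>Alternating functions of the exponent vector\<close>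

text \<open>The entries below \<open>N\<close> determine \<open>w\<close>, so a single term of the
  defining sum survives.\<close>

lemma alternant_perm:
  assumes "w permutes {..<N}" and "\<And>i. i < N \<Longrightarrow> \<beta> i = int (w i)"
  shows "alternant N \<beta> = sign w"
proof -
  have "w' = w" if "w' permutes {..<N}" "\<forall>i<N. \<beta> i = int (w' i)" for w'
  proof
    fix i show "w' i = w i"
      using assms(2)[of i] that permutes_not_in[OF assms(1), of i] permutes_not_in[OF that(1), of i]
      by (cases "i < N") auto
  qed
  then have "alternant N \<beta> = (\<Sum>w' | w' permutes {..<N}. if w' = w then sign w else 0)"
    unfolding alternant_def using assms by (intro sum.cong) auto
  then show ?thesis
    using assms(1) by (simp add: finite_permutations)
qed

lemma alternant_nonzeroE:
  assumes "alternant N \<beta> \<noteq> 0"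
  obtains w where "w permutes {..<N}" "\<And>i. i < N \<Longrightarrow> \<beta> i = int (w i)"
proof -
  have "\<exists>w. w permutes {..<N} \<and> (\<forall>i<N. \<beta> i = int (w i))"
  proof (rule ccontr)
    assume "\<not> ?thesis"
    then have "alternant N \<beta> = 0"
      unfolding alternant_def by (intro sum.neutral) auto
    with assms show False ..
  qed
  then show thesis using that by blast
qed

lemma abs_alternant_le: "\<bar>alternant N \<beta>\<bar> \<le> 1"
proof (cases "alternant N \<beta> = 0")
  case False
  then show ?thesis
    by (elim alternant_nonzeroE) (auto simp: alternant_perm sign_def)
qed auto

text \<open>Swapping two entries composes the matching permutation with a transposition. Where no
  permutation matches, the nonzero case is applied to the swapped vector, since swapping twice is
  the identity.\<close>

lemma alternant_alternating: "alternating N (alternant N)"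
  unfolding alternating_def
proof (intro allI impI)
  fix \<beta> :: "nat \<Rightarrow> int" and i j assume ij: "i < N" "j < N" "i \<noteq> j"
  have *: "alternant N (\<beta> \<circ> Transposition.transpose i j) = - alternant N \<beta>" if nz: "alternant N \<beta> \<noteq> 0" for \<beta> :: "nat \<Rightarrow> int"
  proof -
    from nz obtain w where w: "w permutes {..<N}" "\<And>i. i < N \<Longrightarrow> \<beta> i = int (w i)"
      by (auto elim: alternant_nonzeroE)
    have t: "Transposition.transpose i j permutes {..<N}"
      using ij by (simp add: permutes_swap_id)
    have "alternant N (\<beta> \<circ> Transposition.transpose i j) = sign (w \<circ> Transposition.transpose i j)"
      using w(2) ij by (intro alternant_perm permutes_compose[OF t w(1)]) (auto simp: Transposition.transpose_def)
    also have "\<dots> = - sign w"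
      using permutes_imp_permutation[OF _ w(1)] permutes_imp_permutation[OF _ t] ij
      by (simp add: sign_compose sign_swap_id)
    finally show ?thesis
      using w by (simp add: alternant_perm)
  qed
  show "alternant N (\<beta> \<circ> Transposition.transpose i j) = - alternant N \<beta>"
  proof (cases "alternant N \<beta> = 0")
    case True
    have "(\<beta> \<circ> Transposition.transpose i j) \<circ> Transposition.transpose i j = \<beta>"
      by (simp add: comp_assoc)
    then have "alternant N (\<beta> \<circ> Transposition.transpose i j) = 0"
      using *[of "\<beta> \<circ> Transposition.transpose i j"] True by fastforce
    then show ?thesis
      using True by simp
  qed (rule *)
qed

lemma alternating_eq_0:
  assumes "alternating N \<phi>" "\<not> inj_on \<beta> {..<N}"
  shows "\<phi> \<beta> = 0"
proof -
  obtain i j where ij: "i < N" "j < N" "i \<noteq> j" "\<beta> i = \<beta> j"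
    using assms(2) by (auto simp: inj_on_def)
  then have "\<beta> \<circ> Transposition.transpose i j = \<beta>"
    by (auto simp: Transposition.transpose_def)
  then have "\<phi> \<beta> = - \<phi> \<beta>"
    using assms(1) ij unfolding alternating_def by metis
  then show ?thesis by simp
qed

text \<open>A swap of positions merely permutes the summands. The guard \<open>P\<close> looks at
  the value of a bead, not at its position, so that cutoffs such as \<open>\<beta> i < int l\<close>
  are covered.\<close>

lemma alternating_sum_bump:
  assumes "alternating N \<phi>"
  shows "alternating N (\<lambda>\<beta>. \<Sum>i<N. if P (\<beta> i) then \<phi> (bump \<beta> i m) else 0)"
  unfolding alternating_def
proof (intro allI impI)
  fix \<beta> :: "nat \<Rightarrow> int" and i j assume ij: "i < N" "j < N" "i \<noteq> j"
  let ?t = "Transposition.transpose i j"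
  have bump: "bump (\<beta> \<circ> ?t) k m = bump \<beta> (?t k) m \<circ> ?t" for k
    by (auto simp: bump_def fun_eq_iff Transposition.transpose_def)
  have "(\<Sum>k<N. if P ((\<beta> \<circ> ?t) k) then \<phi> (bump (\<beta> \<circ> ?t) k m) else 0)
      = (\<Sum>k<N. if P (\<beta> (?t k)) then - \<phi> (bump \<beta> (?t k) m) else 0)"
    using assms ij unfolding alternating_def bump by (intro sum.cong) auto
  also have "\<dots> = (\<Sum>k<N. if P (\<beta> k) then - \<phi> (bump \<beta> k m) else 0)"
    using ij by (intro sum.permute[unfolded comp_def, symmetric] permutes_swap_id) auto
  finally show "(\<Sum>k<N. if P ((\<beta> \<circ> ?t) k) then \<phi> (bump (\<beta> \<circ> ?t) k m) else 0)
      = - (\<Sum>k<N. if P (\<beta> k) then \<phi> (bump \<beta> k m) else 0)"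
    by (simp add: if_distrib sum_negf[symmetric] cong: if_cong)
qed

section \<open>Recursion and support of the coefficients\<close>

lemma frob_empty [simp]: "frob N s {} = alternant N"
  by (rule ext) (simp add: frob_def colour_content_def)

text \<open>The colour \<open>i\<close> given to the new element takes \<open>s x\<close> away from
  position \<open>i\<close> and leaves the rest of the colouring free.\<close>

lemma frob_insert:
  assumes "finite S" "x \<notin> S"
  shows "frob N s (insert x S) \<beta> = (\<Sum>i<N. frob N s S (bump \<beta> i (- int (s x))))"
proof -
  have cont: "colour_content s (insert x S) (c(x := i)) j
      = colour_content s S c j + (if j = i then s x else 0)" for c i j
  proof -
    have "{y. y \<in> insert x S \<and> (c(x := i)) y = j}
        = (if j = i then insert x {y \<in> S. c y = j} else {y \<in> S. c y = j})"
      using assms(2) by auto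
    then show ?thesis
      using assms unfolding colour_content_def by auto
  qed
  have "frob N s (insert x S) \<beta>
      = (\<Sum>(i, c)\<in>{..<N} \<times> (S \<rightarrow>\<^sub>E {..<N}).
          alternant N (\<lambda>j. \<beta> j - int (colour_content s (insert x S) (c(x := i)) j)))"
    unfolding frob_def PiE_insert_eq using inj_combinator[OF assms(2)]
    by (subst sum.reindex) (auto simp: case_prod_unfold)
  also have "\<dots> = (\<Sum>(i, c)\<in>{..<N} \<times> (S \<rightarrow>\<^sub>E {..<N}).
          alternant N (\<lambda>j. bump \<beta> i (- int (s x)) j - int (colour_content s S c j)))"
    unfolding cont
    by (intro sum.cong refl) (auto intro!: arg_cong[where f = "alternant N"] simp: bump_def)
  finally show ?thesis
    by (simp add: frob_def sum.cartesian_product)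
qed

lemma alternating_frob: "finite S \<Longrightarrow> alternating N (frob N s S)"
proof (induction S rule: finite_induct)
  case (insert x S)
  then have "alternating N (\<lambda>\<beta>. \<Sum>i<N. if True then frob N s S (bump \<beta> i (- int (s x))) else 0)"
    by (intro alternating_sum_bump)
  moreover have "frob N s (insert x S)
      = (\<lambda>\<beta>. \<Sum>i<N. if True then frob N s S (bump \<beta> i (- int (s x))) else 0)"
    using insert by (simp add: frob_insert fun_eq_iff)
  ultimately show ?case by simp
qed (simp add: alternant_alternating)

lemma sum_colour_content:
  assumes "finite S" "c \<in> S \<rightarrow> {..<N}"
  shows "(\<Sum>i<N. colour_content s S c i) = sum s S"
  unfolding colour_content_def using assms by (intro sum.group) auto

lemma colour_content_le: "finite S \<Longrightarrow> colour_content s S c i \<le> sum s S"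
  unfolding colour_content_def by (intro sum_mono2) auto

text \<open>A nonzero coefficient has a colouring for which \<open>\<beta>\<close> minus the content
  is a permutation of \<open>{..<N}\<close>. Range and total are read off from this; injectivity
  comes from the alternating property.\<close>

lemma frob_nonzeroD:
  assumes "frob N s S \<beta> \<noteq> 0" "finite S"
  shows "inj_on \<beta> {..<N}"
    and "\<And>i. i < N \<Longrightarrow> 0 \<le> \<beta> i"
    and "\<And>i. i < N \<Longrightarrow> \<beta> i < int N + int (sum s S)"
    and "(\<Sum>i<N. \<beta> i) = (\<Sum>i<N. int i) + int (sum s S)"
proof -
  show "inj_on \<beta> {..<N}"
    using alternating_eq_0[OF alternating_frob] assms by blast
  obtain c where c: "c \<in> S \<rightarrow>\<^sub>E {..<N}" "alternant N (\<lambda>i. \<beta> i - int (colour_content s S c i)) \<noteq> 0"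
    using assms(1) unfolding frob_def by (rule sum.not_neutral_contains_not_neutral)
  then obtain w where w: "w permutes {..<N}" "\<And>i. i < N \<Longrightarrow> \<beta> i - int (colour_content s S c i) = int (w i)"
    by (auto elim: alternant_nonzeroE)
  have \<beta>: "\<beta> i = int (w i) + int (colour_content s S c i)" if "i < N" for i
    using w(2)[OF that] by simp
  show "0 \<le> \<beta> i" if "i < N" for i
    using \<beta>[OF that] by simp
  show "\<beta> i < int N + int (sum s S)" if "i < N" for i
    using \<beta>[OF that] colour_content_le[OF assms(2), of s c i] permutes_in_image[OF w(1), of i] that
    by (simp del: of_nat_sum)
  have "(\<Sum>i<N. \<beta> i) = (\<Sum>i<N. int (w i)) + (\<Sum>i<N. int (colour_content s S c i))"
    by (simp add: \<beta> sum.distrib)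
  also have "(\<Sum>i<N. int (w i)) = (\<Sum>i<N. int i)"
    using sum.permute[OF w(1), of int] by (simp add: comp_def)
  also have "(\<Sum>i<N. int (colour_content s S c i)) = int (sum s S)"
    using sum_colour_content[OF assms(2), of c N s] c(1) by (simp flip: of_nat_sum) blast
  finally show "(\<Sum>i<N. \<beta> i) = (\<Sum>i<N. int i) + int (sum s S)" .
qed

section \<open>The Murnaghan--Nakayama bound\<close>

text \<open>When the set is built in increasing order, each new maximum is at least the number of
  elements before it.\<close>

lemma sum_card_le_sum: "finite A \<Longrightarrow> \<Sum>{..<card A} \<le> \<Sum>A" for A :: "nat set"
proof (induction A rule: finite_linorder_max_induct)
  case (insert b A)
  then have "card A \<le> card {..<b}"
    by (intro card_mono) auto
  moreover have "b \<notin> A"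
    using insert by blast
  ultimately show ?case
    using insert by (simp add: lessThan_Suc)
qed auto

lemma inj_on_sum_ge:
  assumes "inj_on \<beta> {..<N}" and "\<And>i. i < N \<Longrightarrow> 0 \<le> \<beta> i"
  shows "(\<Sum>i<N. int i) \<le> (\<Sum>i<N. \<beta> i)"
proof -
  have inj: "inj_on (nat \<circ> \<beta>) {..<N}"
    using assms by (auto simp: inj_on_def nat_eq_iff)
  have "\<Sum>{..<card ((nat \<circ> \<beta>) ` {..<N})} \<le> \<Sum>((nat \<circ> \<beta>) ` {..<N})"
    by (intro sum_card_le_sum) auto
  then have "(\<Sum>i<N. i) \<le> (\<Sum>i<N. nat (\<beta> i))"
    using inj by (simp only: card_image sum.reindex card_lessThan comp_def id_apply)
  then have "int (\<Sum>i<N. i) \<le> int (\<Sum>i<N. nat (\<beta> i))"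
    by (rule of_nat_mono)
  also have "\<dots> = (\<Sum>i<N. \<beta> i)"
    using assms(2) by simp
  finally show ?thesis by simp
qed

text \<open>Were \<open>v\<close> missing, appending it at position \<open>N\<close> would give
  \<open>Suc N\<close> distinct nonnegative entries whose total is below the least possible one,
  because \<open>v + int r < int N\<close>.\<close>

lemma inj_on_value_taken:
  assumes "inj_on \<beta> {..<N}" and "\<And>i. i < N \<Longrightarrow> 0 \<le> \<beta> i"
    and "(\<Sum>i<N. \<beta> i) = (\<Sum>i<N. int i) + int r"
    and "0 \<le> v" "v + int r < int N"
  shows "\<exists>i<N. \<beta> i = v"
proof (rule ccontr)
  assume v: "\<not> ?thesis"
  have "(\<Sum>i<Suc N. int i) \<le> (\<Sum>i<Suc N. (\<beta>(N := v)) i)"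
    using assms(1,2,4) v by (intro inj_on_sum_ge) (auto simp: inj_on_def less_Suc_eq)
  then show False
    using assms(3,5) by simp
qed

lemma abs_frob_le:
  assumes "finite S" and "\<And>x. x \<in> S \<Longrightarrow> 0 < s x"
  shows "\<bar>frob N s S \<beta>\<bar> \<le> fact (card S)"
  using assms
proof (induction "card S" arbitrary: S \<beta>)
  case 0
  then show ?case by (simp add: abs_alternant_le)
next
  case (Suc k)
  have ne: "S \<noteq> {}" using Suc.hyps(2) by auto
  \<comment> \<open>A largest part is removed because then
    \<open>sum s S \<le> card S * s x\<close>, which limits the number of nonzero terms.\<close>
  obtain x where x: "x \<in> S" "\<And>y. y \<in> S \<Longrightarrow> s y \<le> s x"
    using Max_in[of "s ` S"] Max_ge[of "s ` S"] ne Suc.prems(1) by fastforce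
  define S' where "S' = S - {x}"
  define I where "I = {i \<in> {..<N}. frob N s S' (bump \<beta> i (- int (s x))) \<noteq> 0}"
  have S': "S = insert x S'" "x \<notin> S'" "finite S'" "card S' = k"
    using x(1) Suc by (auto simp: S'_def)
  have frob: "frob N s S \<beta> = (\<Sum>i\<in>I. frob N s S' (bump \<beta> i (- int (s x))))"
    unfolding S'(1) frob_insert[OF S'(3,2)] I_def by (intro sum.mono_neutral_right) auto
  show ?case
  proof (cases "frob N s S \<beta> = 0")
    case False
    note \<beta> = frob_nonzeroD[OF False Suc.prems(1)]
    have I: "inj_on (bump \<beta> i (- int (s x))) {..<N}" "int (s x) \<le> \<beta> i" if "i \<in> I" for i
      using that frob_nonzeroD(1,2)[OF _ S'(3), of N s "bump \<beta> i (- int (s x))"]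
      by (force simp: I_def)+
    \<comment> \<open>All contributing moves are made at once. Two moved beads keep their distance,
      and a moved bead avoids an unmoved one because its own single move already leaves distinct
      beads.\<close>
    define \<gamma> where "\<gamma> i = (if i \<in> I then \<beta> i - int (s x) else \<beta> i)" for i
    have "inj_on \<gamma> {..<N}"
    proof (rule inj_onI)
      have *: "\<gamma> i \<noteq> \<gamma> j" if "i \<in> I" "i < N" "j < N" "i \<noteq> j" for i j
      proof
        assume eq: "\<gamma> i = \<gamma> j"
        show False
        proof (cases "j \<in> I")
          case True
          then have "\<beta> i = \<beta> j" using eq that by (simp add: \<gamma>_def)
          then show False using \<beta>(1) that by (auto simp: inj_on_def)
        next
          case False
          then have "bump \<beta> i (- int (s x)) i = bump \<beta> i (- int (s x)) j"
            using eq that by (simp add: \<gamma>_def)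
          then show False using I(1)[OF that(1)] that unfolding inj_on_def by blast
        qed
      qed
      fix i j assume "i \<in> {..<N}" "j \<in> {..<N}" "\<gamma> i = \<gamma> j"
      then show "i = j"
        using *[of i j] *[of j i] \<beta>(1) by (cases "i \<in> I"; cases "j \<in> I") (auto simp: \<gamma>_def inj_on_def)
    qed
    moreover have "0 \<le> \<gamma> i" if "i < N" for i
      using I(2) \<beta>(2) that by (auto simp: \<gamma>_def)
    ultimately have "(\<Sum>i<N. int i) \<le> (\<Sum>i<N. \<gamma> i)"
      by (rule inj_on_sum_ge)
    also have "(\<Sum>i<N. \<gamma> i) = (\<Sum>i<N. \<beta> i - (if i \<in> I then int (s x) else 0))"
      by (intro sum.cong) (auto simp: \<gamma>_def)
    also have "\<dots> = (\<Sum>i<N. \<beta> i) - (\<Sum>i\<in>{..<N} \<inter> I. int (s x))"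
      by (simp add: sum_subtractf sum.If_cases)
    also have "{..<N} \<inter> I = I"
      by (auto simp: I_def)
    \<comment> \<open>Each move lowers the total by \<open>s x\<close>, and the total of
      \<open>\<beta>\<close> exceeds the least possible one by exactly
      \<open>sum s S\<close>.\<close>
    finally have "int (card I) * int (s x) \<le> int (sum s S)"
      using \<beta>(4) by simp
    then have "card I * s x \<le> sum s S"
      by (simp only: of_nat_mult[symmetric] of_nat_le_iff)
    also have "\<dots> \<le> card S * s x"
      using sum_bounded_above[of S s "s x"] x(2) by simp
    finally have card: "card I \<le> card S"
      using Suc.prems(2)[OF x(1)] by simp
    have "\<bar>frob N s S \<beta>\<bar> \<le> (\<Sum>i\<in>I. \<bar>frob N s S' (bump \<beta> i (- int (s x)))\<bar>)"
      unfolding frob by (rule sum_abs)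
    also have "\<dots> \<le> (\<Sum>i\<in>I. fact k)"
      using Suc.hyps(1)[of S'] S' Suc.prems by (intro sum_mono) auto
    also have "\<dots> = int (card I) * fact k"
      by simp
    also have "\<dots> \<le> int (card S) * fact k"
      using card by (intro mult_right_mono) auto
    also have "\<dots> = fact (card S)"
      using Suc.hyps(2) by (metis fact_Suc of_nat_mult of_nat_fact)
    finally show ?thesis .
  qed simp
qed

section \<open>Column orthogonality\<close>

text \<open>The adjoint of multiplication by a power sum acts as a derivation: the two commute up to the
  beads that would pass below zero, and these contribute only when the degrees agree.\<close>

lemma frob_raise:
  assumes "finite S" and "\<And>x. x \<in> S \<Longrightarrow> 0 < s x" and "sum s S \<le> N" and "0 < m"
    and "\<And>i. i < N \<Longrightarrow> 0 \<le> \<beta> i"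
  shows "(\<Sum>i<N. frob N s S (bump \<beta> i (int m)))
       = (\<Sum>x | x \<in> S \<and> s x = m. int m * frob N s (S - {x}) \<beta>)"
  using assms
proof (induction S arbitrary: \<beta> rule: finite_induct)
  case empty
  \<comment> \<open>If the sum were nonzero, \<open>\<beta>\<close> would be injective, so its total
    would already be at least that of the alternant, and raising a bead by \<open>m > 0\<close>
    would overshoot.\<close>
  have alt: "alternating N (\<lambda>\<beta>. \<Sum>i<N. if True then alternant N (bump \<beta> i (int m)) else 0)"
    by (intro alternating_sum_bump alternant_alternating)
  have "(\<Sum>i<N. alternant N (bump \<beta> i (int m))) = 0"
  proof (rule ccontr)
    assume nz: "(\<Sum>i<N. alternant N (bump \<beta> i (int m))) \<noteq> 0"
    then have "inj_on \<beta> {..<N}"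
      using alternating_eq_0[OF alt] by auto
    then have "(\<Sum>i<N. int i) \<le> (\<Sum>i<N. \<beta> i)"
      using empty by (intro inj_on_sum_ge) auto
    moreover obtain i where "i < N" "frob N s {} (bump \<beta> i (int m)) \<noteq> 0"
      using nz by (rule sum.not_neutral_contains_not_neutral) auto
    ultimately show False
      using frob_nonzeroD(4)[of N s "{}" "bump \<beta> i (int m)"] empty by (simp add: sum_bump)
  qed
  then show ?case by simp
next
  case (insert x S)
  define l where "l = s x"
  let ?f = "frob N s S"
  have l: "0 < l" "sum s S + l \<le> N"
    using insert by (auto simp: l_def)
  note nonzero = frob_nonzeroD[OF _ insert.hyps(1), of N s]
  \<comment> \<open>A bead lowered below zero can only be saved by raising the same bead, so for
    \<open>\<beta> j < int l\<close> just the term \<open>i = j\<close> survives, with net shift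
    \<open>m - l\<close>. For the other \<open>j\<close> the lowered vector is nonnegative and the
    induction hypothesis applies.\<close>
  define low where "low = (\<Sum>j<N. if \<beta> j < int l then ?f (bump \<beta> j (int m - int l)) else 0)"
  define high where "high = (\<Sum>j<N. if \<beta> j < int l then 0
      else (\<Sum>i<N. ?f (bump (bump \<beta> j (- int l)) i (int m))))"
  have "(\<Sum>i<N. frob N s (insert x S) (bump \<beta> i (int m)))
      = (\<Sum>j<N. \<Sum>i<N. ?f (bump (bump \<beta> j (- int l)) i (int m)))"
    by (subst sum.swap) (simp add: frob_insert insert l_def bump_commute)
  also have "\<dots> = (\<Sum>j<N. (if \<beta> j < int l then ?f (bump \<beta> j (int m - int l)) else 0)
      + (if \<beta> j < int l then 0 else (\<Sum>i<N. ?f (bump (bump \<beta> j (- int l)) i (int m)))))"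
  proof (intro sum.cong refl)
    fix j assume j: "j \<in> {..<N}"
    have "(\<Sum>i<N. ?f (bump (bump \<beta> j (- int l)) i (int m))) = ?f (bump \<beta> j (int m - int l))"
      if "\<beta> j < int l"
    proof -
      have "?f (bump (bump \<beta> j (- int l)) i (int m)) = 0" if "i \<noteq> j" for i
        using nonzero(2)[of "bump (bump \<beta> j (- int l)) i (int m)" j] j that \<open>\<beta> j < int l\<close> by force
      then have "(\<Sum>i<N. ?f (bump (bump \<beta> j (- int l)) i (int m)))
          = (\<Sum>i<N. if i = j then ?f (bump \<beta> j (int m - int l)) else 0)"
        by (intro sum.cong) (auto simp: add.commute)
      then show ?thesis using j by simp
    qed
    then show "(\<Sum>i<N. ?f (bump (bump \<beta> j (- int l)) i (int m)))
        = (if \<beta> j < int l then ?f (bump \<beta> j (int m - int l)) else 0)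
      + (if \<beta> j < int l then 0 else (\<Sum>i<N. ?f (bump (bump \<beta> j (- int l)) i (int m))))"
      by simp
  qed
  also have "\<dots> = low + high"
    by (simp add: sum.distrib low_def high_def)
  finally have split: "(\<Sum>i<N. frob N s (insert x S) (bump \<beta> i (int m))) = low + high" .

  have "high = (\<Sum>j<N. \<Sum>y | y \<in> S \<and> s y = m. int m * frob N s (S - {y}) (bump \<beta> j (- int l)))"
    unfolding high_def
  proof (intro sum.cong refl)
    fix j assume j: "j \<in> {..<N}"
    show "(if \<beta> j < int l then 0 else (\<Sum>i<N. ?f (bump (bump \<beta> j (- int l)) i (int m))))
      = (\<Sum>y | y \<in> S \<and> s y = m. int m * frob N s (S - {y}) (bump \<beta> j (- int l)))"
    proof (cases "\<beta> j < int l")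
      case True
      \<comment> \<open>The terms cut out of \<open>high\<close> are zero on the right as well, bead
        \<open>j\<close> being negative there. The sum over \<open>j\<close> thus becomes complete,
        as \<open>frob_insert\<close> requires.\<close>
      have "frob N s (S - {y}) (bump \<beta> j (- int l)) = 0" for y
        using frob_nonzeroD(2)[of N s "S - {y}" "bump \<beta> j (- int l)" j] True j insert.hyps(1) by force
      then show ?thesis using True by simp
    next
      case False
      have "0 \<le> bump \<beta> j (- int l) i" if "i < N" for i
        using insert.prems(4)[OF that] False by (cases "i = j") auto
      then show ?thesis
        using False insert.IH[of "bump \<beta> j (- int l)"] insert.prems insert.hyps by auto
    qed
  qed
  also have "\<dots> = (\<Sum>y | y \<in> S \<and> s y = m. int m * frob N s (insert x (S - {y})) \<beta>)"
    using insert.hyps by (subst sum.swap) (simp add: frob_insert l_def sum_distrib_left)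
  also have "\<dots> = (\<Sum>y | y \<in> S \<and> s y = m. int m * frob N s (insert x S - {y}) \<beta>)"
  proof (intro sum.cong refl)
    fix y assume "y \<in> {y. y \<in> S \<and> s y = m}"
    then have "insert x (S - {y}) = insert x S - {y}"
      using insert.hyps(2) by auto
    then show "int m * frob N s (insert x (S - {y})) \<beta> = int m * frob N s (insert x S - {y}) \<beta>"
      by simp
  qed
  finally have high: "high = (\<Sum>y | y \<in> S \<and> s y = m. int m * frob N s (insert x S - {y}) \<beta>)" .

  have low: "low = (if l = m then int m * ?f \<beta> else 0)"
  proof (cases "l = m")
    case True
    \<comment> \<open>Each bead below \<open>m\<close> contributes \<open>?f \<beta>\<close> to
      \<open>low\<close>, and \<open>sum s S + m \<le> N\<close> forces every value from 0 to
      \<open>m - 1\<close> to be occupied.\<close>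
    have "card {j. j < N \<and> \<beta> j < int m} = m" if nz: "?f \<beta> \<noteq> 0"
    proof -
      have "bij_betw \<beta> {j. j < N \<and> \<beta> j < int m} {0..<int m}"
        unfolding bij_betw_def
      proof
        show "inj_on \<beta> {j. j < N \<and> \<beta> j < int m}"
          using nonzero(1)[OF nz] by (auto simp: inj_on_def)
        have "\<exists>i<N. \<beta> i = v" if "0 \<le> v" "v < int m" for v
          using l(2) that True
          by (intro inj_on_value_taken[OF nonzero(1)[OF nz] nonzero(2)[OF nz] nonzero(4)[OF nz]])
            (auto simp del: of_nat_sum)
        then show "\<beta> ` {j. j < N \<and> \<beta> j < int m} = {0..<int m}"
          using insert.prems(4) by fastforce
      qed
      then show ?thesis
        by (simp add: bij_betw_same_card)
    qed
    moreover have "low = int (card {j. j < N \<and> \<beta> j < int m}) * ?f \<beta>"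
      unfolding low_def using True by (simp add: sum.If_cases Int_def lessThan_def conj_commute)
    ultimately show ?thesis
      using True by (cases "?f \<beta> = 0") auto
  next
    case False
    have "low = 0"
    proof (rule ccontr)
      assume nz: "low \<noteq> 0"
      have "alternating N (\<lambda>\<beta>. \<Sum>j<N. if \<beta> j < int l then ?f (bump \<beta> j (int m - int l)) else 0)"
        by (intro alternating_sum_bump alternating_frob insert.hyps)
      note alt = this
      have inj: "inj_on \<beta> {..<N}"
      proof (rule ccontr)
        assume "\<not> inj_on \<beta> {..<N}"
        from alternating_eq_0[OF alt this] nz show False
          unfolding low_def by contradiction
      qed
      obtain j where j: "j < N" "\<beta> j < int l" "?f (bump \<beta> j (int m - int l)) \<noteq> 0"
        using nz unfolding low_def
        by (rule sum.not_neutral_contains_not_neutral) (auto split: if_splits)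
      \<comment> \<open>The value \<open>\<beta> j < int l\<close> must still be occupied after the
        move. Since \<open>l \<noteq> m\<close>, another bead occupies it, contradicting injectivity
        of \<open>\<beta>\<close>.\<close>
      have "\<exists>i<N. bump \<beta> j (int m - int l) i = \<beta> j"
        using j insert.prems(4) l(2)
        by (intro inj_on_value_taken[OF nonzero(1)[OF j(3)] nonzero(2)[OF j(3)] nonzero(4)[OF j(3)]])
          (auto simp del: of_nat_sum)
      then obtain i where "i < N" "bump \<beta> j (int m - int l) i = \<beta> j"
        by blast
      then show False
        using inj j(1) False by (cases "i = j") (auto simp: inj_on_def)
    qed
    then show ?thesis using False by simp
  qed

  have "{y. y \<in> insert x S \<and> s y = m}
      = (if l = m then insert x {y. y \<in> S \<and> s y = m} else {y. y \<in> S \<and> s y = m})"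
    by (auto simp: l_def)
  then have "(\<Sum>y | y \<in> insert x S \<and> s y = m. int m * frob N s (insert x S - {y}) \<beta>) = low + high"
    using insert.hyps by (simp add: low high)
  then show ?case
    using split by simp
qed

section \<open>The coefficient pairing on a finite window\<close>

text \<open>A finite window of exponent vectors. Extensionality picks one representative of each
  vector, as \<open>frob\<close> depends only on the entries below \<open>N\<close>.\<close>

abbreviation box :: "nat \<Rightarrow> nat \<Rightarrow> (nat \<Rightarrow> int) set" where
  "box N M \<equiv> {..<N} \<rightarrow>\<^sub>E {0..<int M}"

lemma finite_box [simp]: "finite (box N M)"
  by (intro finite_PiE) auto

text \<open>For each \<open>i\<close> this is a shift of the summation variable. Vectors pushed out
  of the window contribute nothing: \<open>\<phi>\<close> vanishes at negative entries and
  \<open>\<psi>\<close> at entries from \<open>M\<close> on.\<close>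

lemma sum_bump_adjoint:
  fixes \<phi> \<psi> :: "(nat \<Rightarrow> int) \<Rightarrow> int"
  assumes \<phi>: "\<And>\<beta> i. \<phi> \<beta> \<noteq> 0 \<Longrightarrow> i < N \<Longrightarrow> 0 \<le> \<beta> i"
    and \<psi>: "\<And>\<beta> i. \<psi> \<beta> \<noteq> 0 \<Longrightarrow> i < N \<Longrightarrow> \<beta> i < int M"
  shows "(\<Sum>\<beta>\<in>box N M. (\<Sum>i<N. \<phi> (bump \<beta> i (- int a))) * \<psi> \<beta>)
       = (\<Sum>\<beta>\<in>box N M. \<phi> \<beta> * (\<Sum>i<N. \<psi> (bump \<beta> i (int a))))"
proof -
  have "(\<Sum>\<beta>\<in>box N M. \<phi> (bump \<beta> i (- int a)) * \<psi> \<beta>)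
      = (\<Sum>\<beta>\<in>box N M. \<phi> \<beta> * \<psi> (bump \<beta> i (int a)))" if i: "i < N" for i
  proof -
    let ?L = "{\<beta> \<in> box N M. int a \<le> \<beta> i}" and ?R = "{\<beta> \<in> box N M. \<beta> i + int a < int M}"
    have "(\<Sum>\<beta>\<in>box N M. \<phi> (bump \<beta> i (- int a)) * \<psi> \<beta>)
        = (\<Sum>\<beta>\<in>?L. \<phi> (bump \<beta> i (- int a)) * \<psi> \<beta>)"
    proof (intro sum.mono_neutral_right ballI finite_box)
      fix \<beta> assume "\<beta> \<in> box N M - ?L"
      then have "\<not> int a \<le> \<beta> i" by blast
      then have "bump \<beta> i (- int a) i < 0" by simp
      then have "\<phi> (bump \<beta> i (- int a)) = 0"
        using \<phi>[of "bump \<beta> i (- int a)" i] i by linarith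
      then show "\<phi> (bump \<beta> i (- int a)) * \<psi> \<beta> = 0" by simp
    qed auto
    also have "\<dots> = (\<Sum>\<beta>\<in>?R. \<phi> \<beta> * \<psi> (bump \<beta> i (int a)))"
    proof (rule sum.reindex_bij_witness[where i = "\<lambda>\<beta>. bump \<beta> i (int a)" and j = "\<lambda>\<beta>. bump \<beta> i (- int a)"])
      fix \<beta> assume \<beta>: "\<beta> \<in> ?L"
      then have lt: "\<beta> i < int M" using i PiE_mem[of \<beta> "{..<N}" _ i] by fastforce
      have "\<beta> i - int a < int M" using lt by simp
      then show "bump \<beta> i (- int a) \<in> ?R" using \<beta> i by (auto simp: bump_def PiE_iff extensional_def)
    next
      fix \<beta> assume \<beta>: "\<beta> \<in> ?R"
      then have "0 \<le> \<beta> i" using i PiE_mem[of \<beta> "{..<N}" _ i] by fastforce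
      then show "bump \<beta> i (int a) \<in> ?L" using \<beta> i by (auto simp: bump_def PiE_iff extensional_def)
    qed auto
    also have "\<dots> = (\<Sum>\<beta>\<in>box N M. \<phi> \<beta> * \<psi> (bump \<beta> i (int a)))"
    proof (intro sum.mono_neutral_left ballI finite_box)
      fix \<beta> assume "\<beta> \<in> box N M - ?R"
      then have "\<not> \<beta> i + int a < int M" by blast
      then have "int M \<le> bump \<beta> i (int a) i" by simp
      then have "\<psi> (bump \<beta> i (int a)) = 0"
        using \<psi>[of "bump \<beta> i (int a)" i] i by linarith
      then show "\<phi> \<beta> * \<psi> (bump \<beta> i (int a)) = 0" by simp
    qed auto
    finally show ?thesis .
  qed
  then show ?thesis
    unfolding sum_distrib_left sum_distrib_right by (subst (1 2) sum.swap) simp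
qed

text \<open>The inner product of two coefficient families. For finite \<open>T\<close> and
  \<open>M \<ge> N + sum t T\<close> the window contains the whole support of the second
  one.\<close>

definition frob_pairing ::
  "nat \<Rightarrow> nat \<Rightarrow> ('o \<Rightarrow> nat) \<Rightarrow> 'o set \<Rightarrow> ('p \<Rightarrow> nat) \<Rightarrow> 'p set \<Rightarrow> int" where
  "frob_pairing N M s S t T = (\<Sum>\<beta>\<in>box N M. frob N s S \<beta> * frob N t T \<beta>)"

text \<open>Adjointness carries the power sum of \<open>x\<close> to the other factor, where
  \<open>frob_raise\<close> lets it act as a derivation that deletes one element of equal
  degree.\<close>

lemma frob_pairing_insert:
  assumes "finite S" "x \<notin> S" "0 < s x"
    and "finite T" "\<And>y. y \<in> T \<Longrightarrow> 0 < t y" "sum t T \<le> N" "N + sum t T \<le> M"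
  shows "frob_pairing N M s (insert x S) t T
       = (\<Sum>y | y \<in> T \<and> t y = s x. int (s x) * frob_pairing N M s S t (T - {y}))"
proof -
  have "frob_pairing N M s (insert x S) t T
      = (\<Sum>\<beta>\<in>box N M. (\<Sum>i<N. frob N s S (bump \<beta> i (- int (s x)))) * frob N t T \<beta>)"
    using assms by (simp add: frob_pairing_def frob_insert)
  also have "\<dots> = (\<Sum>\<beta>\<in>box N M. frob N s S \<beta> * (\<Sum>i<N. frob N t T (bump \<beta> i (int (s x)))))"
  proof (rule sum_bump_adjoint)
    fix \<beta> i assume "frob N s S \<beta> \<noteq> 0" "i < N"
    then show "0 \<le> \<beta> i" using frob_nonzeroD(2) assms(1) by blast
  next
    fix \<beta> i assume "frob N t T \<beta> \<noteq> 0" "i < N"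
    then show "\<beta> i < int M" using frob_nonzeroD(3)[of N t T \<beta> i] assms(4,7) by linarith
  qed
  also have "\<dots> = (\<Sum>\<beta>\<in>box N M. \<Sum>y | y \<in> T \<and> t y = s x.
      int (s x) * (frob N s S \<beta> * frob N t (T - {y}) \<beta>))"
  proof (intro sum.cong refl)
    fix \<beta> assume \<beta>: "\<beta> \<in> box N M"
    have "0 \<le> \<beta> i" if "i < N" for i
      using PiE_mem[OF \<beta>, of i] that by simp
    then show "frob N s S \<beta> * (\<Sum>i<N. frob N t T (bump \<beta> i (int (s x))))
      = (\<Sum>y | y \<in> T \<and> t y = s x. int (s x) * (frob N s S \<beta> * frob N t (T - {y}) \<beta>))"
      using assms by (simp add: frob_raise sum_distrib_left mult.left_commute)
  qed
  also have "\<dots> = (\<Sum>y | y \<in> T \<and> t y = s x. int (s x) * frob_pairing N M s S t (T - {y}))"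
    unfolding frob_pairing_def sum_distrib_left by (rule sum.swap)
  finally show ?thesis .
qed

text \<open>The alternant has absolute value 1 on the \<open>fact N\<close> vectors that list a
  permutation of \<open>{..<N}\<close> and is zero elsewhere; \<open>N \<le> M\<close> puts these
  vectors in the window.\<close>

lemma frob_pairing_empty:
  assumes "N \<le> M"
  shows "frob_pairing N M s {} t {} = fact N"
proof -
  have "(\<Sum>\<beta>\<in>box N M. alternant N \<beta> * alternant N \<beta>)
      = (\<Sum>w | w permutes {..<N}. \<Sum>\<beta>\<in>box N M. if \<forall>i<N. \<beta> i = int (w i) then sign w * alternant N \<beta> else 0)"
  proof -
    have "alternant N \<beta> * alternant N \<beta>
        = (\<Sum>w | w permutes {..<N}. if \<forall>i<N. \<beta> i = int (w i) then sign w * alternant N \<beta> else 0)" for \<beta>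
      by (subst (1) alternant_def) (auto simp: sum_distrib_right intro!: sum.cong)
    then show ?thesis
      by (subst sum.swap) simp
  qed
  also have "\<dots> = (\<Sum>w | w permutes {..<N}. 1)"
  proof (intro sum.cong refl)
    fix w assume "w \<in> {w. w permutes {..<N}}"
    then have w: "w permutes {..<N}" by simp
    define \<beta>0 where "\<beta>0 = (\<lambda>i\<in>{..<N}. int (w i))"
    have \<beta>0: "\<beta>0 \<in> box N M"
    proof (rule PiE_I)
      fix i assume "i \<in> {..<N}"
      then show "\<beta>0 i \<in> {0..<int M}"
        using permutes_in_image[OF w, of i] assms by (simp add: \<beta>0_def)
    qed (simp add: \<beta>0_def)
    have "(\<Sum>\<beta>\<in>box N M. if \<forall>i<N. \<beta> i = int (w i) then sign w * alternant N \<beta> else 0)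
        = (\<Sum>\<beta>\<in>box N M. if \<beta> = \<beta>0 then 1 else 0)"
    proof (intro sum.cong refl)
      fix \<beta> assume \<beta>: "\<beta> \<in> box N M"
      have "(\<forall>i<N. \<beta> i = int (w i)) \<longleftrightarrow> \<beta> = \<beta>0"
        using PiE_ext[OF \<beta> \<beta>0] by (auto simp: \<beta>0_def)
      then show "(if \<forall>i<N. \<beta> i = int (w i) then sign w * alternant N \<beta> else 0) = (if \<beta> = \<beta>0 then 1 else 0)"
        by (auto simp: alternant_perm[OF w] sign_def)
    qed
    then show "(\<Sum>\<beta>\<in>box N M. if \<forall>i<N. \<beta> i = int (w i) then sign w * alternant N \<beta> else 0) = 1"
      using \<beta>0 by simp
  qed
  also have "\<dots> = fact N"
    by (simp add: card_permutations[of "{..<N}" N])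
  finally show ?thesis
    by (simp add: frob_pairing_def)
qed

text \<open>The two supports lie in total degrees that differ by \<open>sum t T > 0\<close>.\<close>

lemma frob_pairing_empty_left:
  assumes "finite T" "T \<noteq> {}" "\<And>y. y \<in> T \<Longrightarrow> 0 < t y"
  shows "frob_pairing N M s {} t T = 0"
proof -
  have "0 < sum t T"
    using assms by (intro sum_pos) auto
  then have "frob N s {} \<beta> * frob N t T \<beta> = 0" for \<beta>
    using frob_nonzeroD(4)[of N s "{}" \<beta>] frob_nonzeroD(4)[of N t T \<beta>] assms(1)
    by (cases "frob N s {} \<beta> = 0"; cases "frob N t T \<beta> = 0") (simp_all del: frob_empty of_nat_sum)
  then show ?thesis
    unfolding frob_pairing_def by (intro sum.neutral ballI)
qed

section \<open>Equivariant bijections between unions of cycles\<close>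

text \<open>For permutations \<open>g\<close> and \<open>h\<close> of \<open>X = Y\<close> these are
  the conjugators of \<open>g\<close> to \<open>h\<close>. Separate sets \<open>X\<close> and
  \<open>Y\<close> let an induction remove cycles; extensionality makes counting possible.\<close>

definition equivariant_bijections ::
  "('a \<Rightarrow> 'a) \<Rightarrow> 'a set \<Rightarrow> ('b \<Rightarrow> 'b) \<Rightarrow> 'b set \<Rightarrow> ('a \<Rightarrow> 'b) set" where
  "equivariant_bijections g X h Y =
    {f \<in> X \<rightarrow>\<^sub>E Y. bij_betw f X Y \<and> (\<forall>a\<in>X. f (g a) = h (f a))}"

lemma cyclic_on_card_pos: "cyclic_on g A \<Longrightarrow> 0 < card A"
  using finite_cyclic_on[of g A] by (auto simp: card_gt_0_iff cyclic_on_alldef)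

lemma cyclic_on_bij_betw:
  assumes "cyclic_on g A" "a \<in> A"
  shows "bij_betw (\<lambda>n. (g ^^ n) a) {0..<card A} A" and "(g ^^ card A) a = a"
proof -
  have orb: "Orbits.orbit g a = A" "a \<in> Orbits.orbit g a"
    using assms orbit_cyclic_eq3 by fastforce+
  have bij: "bij_betw (\<lambda>n. (g ^^ n) a) {0..<funpow_dist1 g a a} A"
    unfolding bij_betw_def
    using inj_on_funpow_dist1[OF orb(2)] orbit_conv_funpow_dist1[OF orb(2)] orb(1) by simp
  then have "card A = funpow_dist1 g a a"
    using bij_betw_same_card by fastforce
  then show "bij_betw (\<lambda>n. (g ^^ n) a) {0..<card A} A" "(g ^^ card A) a = a"
    using bij funpow_dist1_prop[OF orb(2)] by simp_all
qed

lemma equivariant_funpow: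
  assumes "f \<in> equivariant_bijections g X h Y" "cyclic_on g X" "a \<in> X"
  shows "f ((g ^^ n) a) = (h ^^ n) (f a)"
proof (induction n)
  case (Suc n)
  then show ?case
    using assms cyclic_on_funpow_in[OF assms(2,3)] by (simp add: equivariant_bijections_def)
qed simp

text \<open>Such a bijection is determined by the image of one point \<open>a\<close>, and every
  point of \<open>B\<close> occurs as that image.\<close>

lemma card_equivariant_bijections_cycle:
  assumes A: "cyclic_on g A" and B: "cyclic_on h B" and card: "card A = card B"
  shows "card (equivariant_bijections g A h B) = card B"
proof -
  obtain a where a: "a \<in> A" using A by (auto simp: cyclic_on_def)
  note bij = cyclic_on_bij_betw(1)[OF A a]
  have "bij_betw (\<lambda>f. f a) (equivariant_bijections g A h B) B"
    unfolding bij_betw_def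
  proof (intro conjI inj_onI equalityI subsetI)
    fix f f' assume f: "f \<in> equivariant_bijections g A h B" "f' \<in> equivariant_bijections g A h B"
      and eq: "f a = f' a"
    show "f = f'"
    proof (rule PiE_ext)
      show "f \<in> A \<rightarrow>\<^sub>E B" "f' \<in> A \<rightarrow>\<^sub>E B"
        using f by (auto simp: equivariant_bijections_def)
      fix x assume "x \<in> A"
      then obtain n where "x = (g ^^ n) a"
        using bij by (auto simp: bij_betw_def)
      then show "f x = f' x"
        using equivariant_funpow[OF f(1) A a] equivariant_funpow[OF f(2) A a] eq by simp
    qed
  next
    fix y assume "y \<in> (\<lambda>f. f a) ` equivariant_bijections g A h B"
    then show "y \<in> B" using a by (auto simp: equivariant_bijections_def)
  next
    fix y assume y: "y \<in> B"
    \<comment> \<open>\<open>f\<close> sends the \<open>n\<close>-th iterate of \<open>a\<close> to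
      the \<open>n\<close>-th iterate of \<open>y\<close> for \<open>n\<close> in one period; equal
      cycle lengths extend this to all \<open>n\<close>.\<close>
    define f where "f = (\<lambda>x\<in>A. (h ^^ inv_into {0..<card A} (\<lambda>n. (g ^^ n) a) x) y)"
    have f: "f ((g ^^ n) a) = (h ^^ n) y" for n
    proof -
      have pos: "0 < card A"
        using a finite_cyclic_on[OF A] card_gt_0_iff by blast
      have "(g ^^ n) a = (g ^^ (n mod card A)) a" "(h ^^ n) y = (h ^^ (n mod card A)) y"
        using cyclic_on_bij_betw(2)[OF A a] cyclic_on_bij_betw(2)[OF B y] card
        by (simp_all add: funpow_mod_eq)
      moreover have "inv_into {0..<card A} (\<lambda>n. (g ^^ n) a) ((g ^^ (n mod card A)) a) = n mod card A"
        using bij pos by (intro inv_into_f_f) (auto simp: bij_betw_def)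
      ultimately show ?thesis
        using cyclic_on_funpow_in[OF A a] by (simp add: f_def)
    qed
    have equi: "f (g x) = h (f x)" if "x \<in> A" for x
    proof -
      obtain n where "x = (g ^^ n) a"
        using bij \<open>x \<in> A\<close> by (auto simp: bij_betw_def)
      then show ?thesis using f[of n] f[of "Suc n"] by simp
    qed
    have "f a = y" using f[of 0] by simp
    \<comment> \<open>The image is a cycle of \<open>h\<close> through \<open>y\<close>, hence all
      of \<open>B\<close>; equal cardinality then gives injectivity.\<close>
    moreover have "cyclic_on h (f ` A)"
      using cyclic_on_image[OF A, of h f] equi by simp
    ultimately have img: "f ` A = B"
      using orbit_cyclic_eq3[OF _ imageI[OF a], of h f] orbit_cyclic_eq3[OF B y] by simp
    then have "inj_on f A"
      using finite_cyclic_on[OF A] card by (simp add: eq_card_imp_inj_on)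
    then have "f \<in> equivariant_bijections g A h B"
      using img equi by (auto simp: equivariant_bijections_def bij_betw_def f_def)
    then show "y \<in> (\<lambda>f. f a) ` equivariant_bijections g A h B"
      using \<open>f a = y\<close> by force
  qed
  then show ?thesis by (rule bij_betw_same_card)
qed

lemma cyclic_on_disjoint:
  assumes "cyclic_on g A" "cyclic_on g B" "A \<noteq> B"
  shows "A \<inter> B = {}"
  using assms orbit_cyclic_eq3 by (metis disjoint_iff)

lemma finite_equivariant_bijections:
  "finite X \<Longrightarrow> finite Y \<Longrightarrow> finite (equivariant_bijections g X h Y)"
  unfolding equivariant_bijections_def by (rule finite_subset[OF _ finite_PiE[of X "\<lambda>_. Y"]]) auto

lemma equivariant_bijections_restrict:
  assumes "f \<in> equivariant_bijections g X h Y" "A \<subseteq> X" "\<And>a. a \<in> A \<Longrightarrow> g a \<in> A"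
  shows "restrict f A \<in> equivariant_bijections g A h (f ` A)"
proof -
  have "inj_on f A"
    using assms by (auto simp: equivariant_bijections_def bij_betw_def intro: inj_on_subset)
  then show ?thesis
    using assms by (auto simp: equivariant_bijections_def bij_betw_def)
qed

text \<open>An equivariant bijection carries the cycle \<open>A\<close> onto a cycle
  \<open>B\<close> of the same length and the rest onto the rest, and such pairs can be glued. The
  recursion has the shape of \<open>frob_pairing_insert\<close>.\<close>

lemma card_equivariant_bijections_insert:
  assumes S: "finite S" "\<And>C. C \<in> S \<Longrightarrow> cyclic_on g C" and A: "cyclic_on g A" "A \<notin> S"
    and T: "finite T" "\<And>C. C \<in> T \<Longrightarrow> cyclic_on h C"
  shows "card (equivariant_bijections g (\<Union>(insert A S)) h (\<Union>T))
    = (\<Sum>B | B \<in> T \<and> card B = card A. card A * card (equivariant_bijections g (\<Union>S) h (\<Union>(T - {B}))))"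
proof -
  let ?X = "\<Union>S" and ?Y = "\<Union>T" and ?T = "{B. B \<in> T \<and> card B = card A}"
  let ?P = "SIGMA B:?T. equivariant_bijections g A h B \<times> equivariant_bijections g ?X h (\<Union>(T - {B}))"
  have disj: "A \<inter> ?X = {}"
    using cyclic_on_disjoint[OF A(1)] S A(2) by blast
  have Ag: "g a \<in> A" if "a \<in> A" for a
    using cyclic_on_inI[OF A(1) that] .
  have Xg: "g a \<in> ?X" if "a \<in> ?X" for a
    using that cyclic_on_inI[OF S(2)] by auto
  have Y: "\<Union>(T - {B}) = ?Y - B" if "B \<in> T" for B
    using cyclic_on_disjoint[of h B] T(2) that by blast
  have "bij_betw (\<lambda>f. (f ` A, restrict f A, restrict f ?X))
      (equivariant_bijections g (A \<union> ?X) h ?Y) ?P"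
  proof (rule bij_betw_byWitness[where f' = "\<lambda>(B, f1, f2) x. if x \<in> A then f1 x else f2 x"])
    show "\<forall>f\<in>equivariant_bijections g (A \<union> ?X) h ?Y.
        (case (f ` A, restrict f A, restrict f ?X) of (B, f1, f2) \<Rightarrow> \<lambda>x. if x \<in> A then f1 x else f2 x) = f"
    proof
      fix f assume "f \<in> equivariant_bijections g (A \<union> ?X) h ?Y"
      then have und: "f x = undefined" if "x \<notin> A" "x \<notin> ?X" for x
        using that by (simp add: equivariant_bijections_def PiE_iff extensional_def)
      show "(case (f ` A, restrict f A, restrict f ?X) of
          (B, f1, f2) \<Rightarrow> \<lambda>x. if x \<in> A then f1 x else f2 x) = f"
      proof
        fix x show "(case (f ` A, restrict f A, restrict f ?X) of
            (B, f1, f2) \<Rightarrow> \<lambda>x. if x \<in> A then f1 x else f2 x) x = f x"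
          using und by (cases "x \<in> A"; cases "x \<in> ?X")
            (simp_all only: prod.case restrict_apply if_True if_False not_False_eq_True)
      qed
    qed
    show "\<forall>p\<in>?P. (\<lambda>f. (f ` A, restrict f A, restrict f ?X))
        (case p of (B, f1, f2) \<Rightarrow> \<lambda>x. if x \<in> A then f1 x else f2 x) = p"
    proof
      fix p assume "p \<in> ?P"
      then obtain B f1 f2 where p: "p = (B, f1, f2)"
        and f: "f1 \<in> equivariant_bijections g A h B" "f2 \<in> equivariant_bijections g ?X h (\<Union>(T - {B}))"
        by auto
      let ?f = "\<lambda>x. if x \<in> A then f1 x else f2 x"
      have "?f ` A = B"
        using f(1) by (auto simp: equivariant_bijections_def bij_betw_def)
      moreover have "restrict ?f A = f1"
      proof
        fix x show "restrict ?f A x = f1 x"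
          using PiE_arb[of f1 A "\<lambda>_. B" x] f(1)
          by (cases "x \<in> A") (simp_all add: equivariant_bijections_def)
      qed
      moreover have "restrict ?f ?X = f2"
      proof
        fix x show "restrict ?f ?X x = f2 x"
        proof (cases "x \<in> ?X")
          case True
          then have "x \<notin> A" using disj by blast
          with True show ?thesis by (simp only: restrict_apply if_True if_False)
        next
          case False
          then show ?thesis
            using PiE_arb[of f2 ?X "\<lambda>_. \<Union>(T - {B})" x] f(2)
            by (simp add: equivariant_bijections_def)
        qed
      qed
      ultimately show "(\<lambda>f. (f ` A, restrict f A, restrict f ?X))
          (case p of (B, f1, f2) \<Rightarrow> \<lambda>x. if x \<in> A then f1 x else f2 x) = p"
        by (simp only: prod.case p)
    qed
    show "(\<lambda>f. (f ` A, restrict f A, restrict f ?X)) ` equivariant_bijections g (A \<union> ?X) h ?Y \<subseteq> ?P"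
    proof (rule image_subsetI)
      fix f assume f: "f \<in> equivariant_bijections g (A \<union> ?X) h ?Y"
      then have inj: "inj_on f (A \<union> ?X)" and img: "f ` (A \<union> ?X) = ?Y"
        by (auto simp: equivariant_bijections_def bij_betw_def)
      have cyc: "cyclic_on h (f ` A)"
        using f by (intro cyclic_on_image[OF A(1)]) (auto simp: equivariant_bijections_def)
      obtain a where a: "a \<in> A" using A by (auto simp: cyclic_on_def)
      obtain B where B: "B \<in> T" "f a \<in> B" using a img by blast
      have "f ` A = B"
        using cyclic_on_disjoint[OF cyc T(2)[OF B(1)]] a B(2) by blast
      moreover have "card (f ` A) = card A"
        using inj by (intro card_image inj_on_subset[OF inj]) auto
      moreover have "f ` ?X = ?Y - f ` A"
      proof -
        have "(A \<union> ?X) - A = ?X" using disj by blast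
        then show ?thesis
          using inj_on_image_set_diff[OF inj, of "A \<union> ?X" A] img by simp
      qed
      ultimately show "(f ` A, restrict f A, restrict f ?X) \<in> ?P"
        using B(1) equivariant_bijections_restrict[OF f _ Ag] equivariant_bijections_restrict[OF f _ Xg] Y[OF B(1)]
        by simp
    qed
    show "(\<lambda>(B, f1, f2) x. if x \<in> A then f1 x else f2 x) ` ?P \<subseteq> equivariant_bijections g (A \<union> ?X) h ?Y"
    proof (rule image_subsetI)
      fix p assume "p \<in> ?P"
      then obtain B f1 f2 where p: "p = (B, f1, f2)" and B: "B \<in> T" "card B = card A"
        and f: "f1 \<in> equivariant_bijections g A h B" "f2 \<in> equivariant_bijections g ?X h (\<Union>(T - {B}))"
        by auto
      let ?f = "\<lambda>x. if x \<in> A then f1 x else f2 x"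
      have f1: "f1 \<in> A \<rightarrow>\<^sub>E B" "bij_betw f1 A B" "\<And>a. a \<in> A \<Longrightarrow> f1 (g a) = h (f1 a)"
        using f(1) by (auto simp: equivariant_bijections_def)
      have f2: "f2 \<in> ?X \<rightarrow>\<^sub>E ?Y - B" "bij_betw f2 ?X (?Y - B)" "\<And>a. a \<in> ?X \<Longrightarrow> f2 (g a) = h (f2 a)"
        using f(2) unfolding Y[OF B(1)] by (auto simp: equivariant_bijections_def)
      have notA: "x \<notin> A" if "x \<in> ?X" for x
        using disj that by blast
      have "bij_betw ?f A B"
        using f1(2) by (simp cong: bij_betw_cong)
      moreover have "bij_betw ?f ?X (?Y - B)"
      proof (rule iffD2[OF bij_betw_cong f2(2)])
        show "?f x = f2 x" if "x \<in> ?X" for x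
          using notA[OF that] by (rule if_not_P)
      qed
      ultimately have bijf: "bij_betw ?f (A \<union> ?X) (B \<union> (?Y - B))"
        by (rule bij_betw_combine) auto
      have BY: "B \<union> (?Y - B) = ?Y" using B(1) by blast
      have memf: "?f \<in> A \<union> ?X \<rightarrow>\<^sub>E ?Y"
      proof (rule PiE_I)
        fix x assume "x \<in> A \<union> ?X"
        then show "?f x \<in> ?Y"
          using PiE_mem[OF f1(1), of x] PiE_mem[OF f2(1), of x] BY by (cases "x \<in> A") auto
      next
        fix x assume "x \<notin> A \<union> ?X"
        then show "?f x = undefined" using PiE_arb[OF f2(1), of x] by simp
      qed
      have eqf: "?f (g a) = h (?f a)" if "a \<in> A \<union> ?X" for a
      proof (cases "a \<in> A")
        case False
        then have "a \<in> ?X" using that by blast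
        then show ?thesis using f2(3) notA Xg by simp
      qed (simp add: f1(3) Ag)
      show "(case p of (B, f1, f2) \<Rightarrow> \<lambda>x. if x \<in> A then f1 x else f2 x)
          \<in> equivariant_bijections g (A \<union> ?X) h ?Y"
        unfolding p prod.case equivariant_bijections_def
        by (intro CollectI conjI ballI memf bijf[unfolded BY] eqf)
    qed
  qed
  then have "card (equivariant_bijections g (A \<union> ?X) h ?Y) = card ?P"
    by (rule bij_betw_same_card)
  also have "\<dots> = (\<Sum>B\<in>?T. card (equivariant_bijections g A h B)
      * card (equivariant_bijections g ?X h (\<Union>(T - {B}))))"
    using T S finite_cyclic_on[OF S(2)] finite_cyclic_on[OF T(2)] finite_cyclic_on[OF A(1)]
    by (subst card_SigmaI) (auto intro!: finite_cartesian_product finite_equivariant_bijections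
        simp: card_cartesian_product)
  also have "\<dots> = (\<Sum>B\<in>?T. card A * card (equivariant_bijections g ?X h (\<Union>(T - {B}))))"
    using card_equivariant_bijections_cycle[OF A(1) T(2)] by (intro sum.cong) auto
  finally show ?thesis by simp
qed

text \<open>Both sides obey the same recursion when a cycle is removed from \<open>S\<close>. For
  \<open>S = {}\<close> they are both \<open>fact N\<close> or both zero, according to whether
  \<open>T\<close> is empty.\<close>

lemma frob_pairing_eq_card:
  assumes "finite S" "\<And>C. C \<in> S \<Longrightarrow> cyclic_on g C"
    and "finite T" "\<And>C. C \<in> T \<Longrightarrow> cyclic_on h C"
    and "sum card T \<le> N" "N + sum card T \<le> M"
  shows "frob_pairing N M card S card T
       = fact N * int (card (equivariant_bijections g (\<Union>S) h (\<Union>T)))"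
  using assms
proof (induction S arbitrary: T rule: finite_induct)
  case empty
  have pos: "0 < card C" if "C \<in> T" for C
    using empty(3)[OF that] by (rule cyclic_on_card_pos)
  show ?case
  proof (cases "T = {}")
    case True
    have "equivariant_bijections g {} h {} = {\<lambda>_. undefined}"
      by (auto simp: equivariant_bijections_def bij_betw_def)
    then show ?thesis
      using True empty by (simp add: frob_pairing_empty)
  next
    case False
    then have "\<Union>T \<noteq> {}" using pos by fastforce
    then have "equivariant_bijections g {} h (\<Union>T) = {}"
      by (auto simp: equivariant_bijections_def bij_betw_def)
    then show ?thesis
      using frob_pairing_empty_left[where t = card and s = card, OF empty(2) False pos] by simp
  qed
next
  case (insert A S)
  have "frob_pairing N M card (insert A S) card T
      = (\<Sum>B | B \<in> T \<and> card B = card A. int (card A) * frob_pairing N M card S card (T - {B}))"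
    using insert by (intro frob_pairing_insert) (auto intro: cyclic_on_card_pos)
  also have "\<dots> = (\<Sum>B | B \<in> T \<and> card B = card A.
      int (card A) * (fact N * int (card (equivariant_bijections g (\<Union>S) h (\<Union>(T - {B}))))))"
  proof (intro sum.cong refl arg_cong[where f = "\<lambda>x. _ * x"] insert.IH)
    fix B
    have "sum card (T - {B}) \<le> sum card T"
      using insert.prems by (intro sum_mono2) auto
    then show "sum card (T - {B}) \<le> N" "N + sum card (T - {B}) \<le> M"
      using insert.prems by auto
  qed (use insert.prems in auto)
  also have "\<dots> = fact N * int (card (equivariant_bijections g (\<Union>(insert A S)) h (\<Union>T)))"
    using insert by (subst card_equivariant_bijections_insert) (auto simp: sum_distrib_left mult_ac)
  finally show ?case .
qed

lemma cycles_of_permutation: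
  assumes "g permutes X" "finite X"
  shows "finite (Orbits.orbit g ` X)" "\<Union>(Orbits.orbit g ` X) = X" "\<And>C. C \<in> Orbits.orbit g ` X \<Longrightarrow> cyclic_on g C"
    and "sum card (Orbits.orbit g ` X) = card X"
proof -
  show fin: "finite (Orbits.orbit g ` X)" using assms by simp
  show U: "\<Union>(Orbits.orbit g ` X) = X"
    using permutes_orbit_subset[OF assms(1)] permutation_self_in_orbit[OF permutes_imp_permutation[OF assms(2,1)]]
    by blast
  show cyc: "\<And>C. C \<in> Orbits.orbit g ` X \<Longrightarrow> cyclic_on g C"
    using cyclic_on_orbit[OF assms] by auto
  have "card (\<Union>(Orbits.orbit g ` X)) = sum card (Orbits.orbit g ` X)"
    using cyclic_on_disjoint[OF cyc cyc] finite_cyclic_on[OF cyc]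
    by (intro card_Union_disjoint pairwiseI) (simp_all only: disjnt_def)
  then show "sum card (Orbits.orbit g ` X) = card X" using U by simp
qed

text \<open>The same maps are encoded differently off \<open>X\<close>: as \<open>undefined\<close>
  on one side, as the identity on the other.\<close>

lemma card_equivariant_bijections_permutes:
  assumes "g permutes X" "h permutes X" "finite X"
  shows "card (equivariant_bijections g X h X) = card {x. x permutes X \<and> x \<circ> g = h \<circ> x}"
proof -
  have "bij_betw (\<lambda>x. restrict x X) {x. x permutes X \<and> x \<circ> g = h \<circ> x} (equivariant_bijections g X h X)"
  proof (rule bij_betw_byWitness[where f' = "\<lambda>f x. if x \<in> X then f x else x"])
    show "\<forall>x\<in>{x. x permutes X \<and> x \<circ> g = h \<circ> x}. (\<lambda>a. if a \<in> X then restrict x X a else a) = x"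
      by (auto simp: fun_eq_iff permutes_not_in)
    show "\<forall>f\<in>equivariant_bijections g X h X. restrict (\<lambda>x. if x \<in> X then f x else x) X = f"
      by (simp add: equivariant_bijections_def fun_eq_iff PiE_iff extensional_def)
    show "(\<lambda>x. restrict x X) ` {x. x permutes X \<and> x \<circ> g = h \<circ> x} \<subseteq> equivariant_bijections g X h X"
    proof clarify
      fix x assume x: "x permutes X" "x \<circ> g = h \<circ> x"
      have "bij_betw (restrict x X) X X"
        using permutes_imp_bij[OF x(1)] by (simp cong: bij_betw_cong)
      moreover have "x (g a) = h (x a)" for a
        using x(2) by (metis comp_apply)
      ultimately show "restrict x X \<in> equivariant_bijections g X h X"
        using permutes_in_image[OF x(1)] permutes_in_image[OF assms(1)]
        by (auto simp: equivariant_bijections_def)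
    qed
    show "(\<lambda>f x. if x \<in> X then f x else x) ` equivariant_bijections g X h X
        \<subseteq> {x. x permutes X \<and> x \<circ> g = h \<circ> x}"
    proof clarify
      fix f assume f: "f \<in> equivariant_bijections g X h X"
      let ?f = "\<lambda>x. if x \<in> X then f x else x"
      have "bij_betw ?f X X"
        using f by (simp add: equivariant_bijections_def cong: bij_betw_cong)
      then have "?f permutes X"
        by (intro bij_imp_permutes) auto
      moreover have "?f \<circ> g = h \<circ> ?f"
        using f permutes_in_image[OF assms(1)] permutes_not_in[OF assms(1)] permutes_not_in[OF assms(2)]
        by (auto simp: equivariant_bijections_def fun_eq_iff)
      ultimately show "?f permutes X \<and> ?f \<circ> g = h \<circ> ?f" ..
    qed
  qed
  from bij_betw_same_card[OF this] show ?thesis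
    by (rule sym)
qed

lemma frob_pairing_permutes:
  assumes "g permutes X" "h permutes X" "finite X" "card X \<le> N" "N + card X \<le> M"
  shows "frob_pairing N M card (Orbits.orbit g ` X) card (Orbits.orbit h ` X)
       = fact N * int (card {x. x permutes X \<and> x \<circ> g = h \<circ> x})"
proof -
  note cg = cycles_of_permutation[OF assms(1,3)] and ch = cycles_of_permutation[OF assms(2,3)]
  show ?thesis
    using frob_pairing_eq_card[OF cg(1,3) ch(1,3), of N M] assms
    by (simp add: cg ch card_equivariant_bijections_permutes)
qed

section \<open>Representations of finite groups\<close>

lemma mat_mult_entry:
  assumes "A \<in> carrier_mat n m" "B \<in> carrier_mat m p" "i < n" "j < p"
  shows "(A * B) $$ (i, j) = (\<Sum>k<m. A $$ (i, k) * B $$ (k, j))"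
  using assms by (simp add: scalar_prod_def atLeast0LessThan)

lemma mat_trace_carrier: "A \<in> carrier_mat n m \<Longrightarrow> mat_trace A = (\<Sum>i<n. A $$ (i, i))"
  by (auto simp: mat_trace_def)

lemma mat_trace_mult_commute:
  assumes "A \<in> carrier_mat n m" "B \<in> carrier_mat m n"
  shows "mat_trace (A * B) = mat_trace (B * A)"
proof -
  have "mat_trace (A * B) = (\<Sum>i<n. \<Sum>k<m. A $$ (i, k) * B $$ (k, i))"
    unfolding mat_trace_carrier[OF mult_carrier_mat[OF assms]]
    by (intro sum.cong refl mat_mult_entry[OF assms]) auto
  also have "\<dots> = (\<Sum>k<m. \<Sum>i<n. B $$ (k, i) * A $$ (i, k))"
    by (subst sum.swap) (simp add: mult.commute)
  also have "\<dots> = mat_trace (B * A)"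
    unfolding mat_trace_carrier[OF mult_carrier_mat[OF assms(2,1)]]
    by (intro sum.cong refl mat_mult_entry[OF assms(2,1), symmetric]) auto
  finally show ?thesis .
qed

text \<open>In upper triangular form an idempotent stays idempotent, so each diagonal entry equals
  its own square and is 0 or 1.\<close>

lemma mat_trace_idempotent:
  assumes P: "P \<in> carrier_mat n n" and idem: "P * P = P"
  shows "mat_trace P \<in> \<int>"
proof -
  obtain as where "char_poly P = (\<Prod>a\<leftarrow>as. [:- a, 1:])"
    using char_poly_factorized[OF P] by blast
  then obtain B where B: "B \<in> carrier_mat n n" "upper_triangular B" "similar_mat P B"
    using schur_decomposition_exists[OF P] by blast
  then obtain X Y where wit: "similar_mat_wit P B X Y"
    by (auto simp: similar_mat_def)
  note D = similar_mat_witD2[OF P wit]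
  have "Y * P * X = Y * (X * B * Y) * X"
    using D(3) by simp
  also have "\<dots> = (Y * X) * B * (Y * X)"
    using D(5-7) by (simp add: assoc_mult_mat[where ?n\<^sub>1 = n and ?n\<^sub>2 = n and ?n\<^sub>3 = n and ?n\<^sub>4 = n])
  finally have Beq: "Y * P * X = B"
    using D by simp
  have "B * B = (Y * P * X) * (Y * P * X)"
    by (simp add: Beq)
  also have "\<dots> = Y * P * (X * Y) * P * X"
    using D(4-7) by (simp add: assoc_mult_mat[where ?n\<^sub>1 = n and ?n\<^sub>2 = n and ?n\<^sub>3 = n and ?n\<^sub>4 = n])
  also have "\<dots> = Y * (P * P) * X"
    using D by (simp add: assoc_mult_mat[where ?n\<^sub>1 = n and ?n\<^sub>2 = n and ?n\<^sub>3 = n and ?n\<^sub>4 = n])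
  also have "\<dots> = B"
    using idem Beq by simp
  finally have BB: "B * B = B" .
  have diag: "B $$ (i, i) \<in> \<int>" if i: "i < n" for i
  proof -
    have "B $$ (i, i) = (\<Sum>k<n. B $$ (i, k) * B $$ (k, i))"
      using mat_mult_entry[OF B(1) B(1) i i] BB by simp
    also have "\<dots> = (\<Sum>k<n. if k = i then B $$ (i, i) * B $$ (i, i) else 0)"
    proof (intro sum.cong refl)
      fix k assume k: "k \<in> {..<n}"
      have "B $$ (k', l) = 0" if "l < k'" "k' < n" for k' l
        using B(1,2) that by (auto simp: upper_triangular_def)
      then show "B $$ (i, k) * B $$ (k, i) = (if k = i then B $$ (i, i) * B $$ (i, i) else 0)"
        using i k by (cases k i rule: linorder_cases) auto
    qed
    finally have "B $$ (i, i) = B $$ (i, i) * B $$ (i, i)"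
      using i by simp
    then have "B $$ (i, i) = 0 \<or> B $$ (i, i) = 1"
      by (metis mult_cancel_right1)
    then show ?thesis by auto
  qed
  have "mat_trace P = mat_trace (X * (B * Y))"
    using D by (simp add: assoc_mult_mat[where ?n\<^sub>1 = n and ?n\<^sub>2 = n and ?n\<^sub>3 = n and ?n\<^sub>4 = n])
  also have "\<dots> = mat_trace ((B * Y) * X)"
    using D by (intro mat_trace_mult_commute[of _ n n]) auto
  also have "(B * Y) * X = B"
    using D by (simp add: assoc_mult_mat[where ?n\<^sub>1 = n and ?n\<^sub>2 = n and ?n\<^sub>3 = n and ?n\<^sub>4 = n])
  finally show ?thesis
    using diag B(1) by (auto simp: mat_trace_carrier intro: Ints_sum)
qed

section \<open>Matrix entries of representations and averages over subgroups\<close>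

lemma representationD:
  assumes "representation G d \<rho>"
  shows "group G" 
    and "\<And>x. x \<in> carrier G \<Longrightarrow> \<rho> x \<in> carrier_mat d d"
    and "\<And>x y. x \<in> carrier G \<Longrightarrow> y \<in> carrier G \<Longrightarrow> \<rho> (x \<otimes>\<^bsub>G\<^esub> y) = \<rho> x * \<rho> y"
    and "\<rho> \<one>\<^bsub>G\<^esub> = 1\<^sub>m d"
proof -
  let ?R = "ring_mat TYPE(complex) d ()"
  show G: "group G" using assms by (simp add: representation_def)
  have hom: "\<rho> \<in> hom G (GL_complex d)" using assms by (simp add: representation_def)
  have GL: "group (GL_complex d)"
    unfolding GL_complex_def
    by (intro monoid.units_group ring.is_monoid ring_mat)
  show "\<rho> x \<in> carrier_mat d d" if "x \<in> carrier G" for x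
    using hom_in_carrier[OF hom that]
    by (auto simp: GL_complex_def units_of_def Units_def ring_mat_simps)
  show "\<rho> (x \<otimes>\<^bsub>G\<^esub> y) = \<rho> x * \<rho> y" if "x \<in> carrier G" "y \<in> carrier G" for x y
    using hom_mult[OF hom that] by (simp add: GL_complex_def units_of_def ring_mat_simps)
  show "\<rho> \<one>\<^bsub>G\<^esub> = 1\<^sub>m d"
    using hom_one[OF hom G GL] by (simp add: GL_complex_def units_of_def ring_mat_simps)
qed

lemma representation_entry:
  assumes "representation G d \<rho>" "x \<in> carrier G" "y \<in> carrier G" "i < d" "j < d"
  shows "\<rho> (x \<otimes>\<^bsub>G\<^esub> y) $$ (i, j) = (\<Sum>k<d. \<rho> x $$ (i, k) * \<rho> y $$ (k, j))"
  using representationD(2,3)[OF assms(1)] assms by (simp add: mat_mult_entry[of _ d d _ d])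

lemma mat_trace_representation_commute:
  assumes "representation G d \<rho>" "x \<in> carrier G" "y \<in> carrier G"
  shows "mat_trace (\<rho> (x \<otimes>\<^bsub>G\<^esub> y)) = mat_trace (\<rho> (y \<otimes>\<^bsub>G\<^esub> x))"
  using representationD(2,3)[OF assms(1)] assms by (simp add: mat_trace_mult_commute[of _ d d])

text \<open>The average of \<open>\<rho>\<close> over \<open>H\<close> is idempotent, being the
  projection onto the vectors fixed by \<open>H\<close>, so its trace is an integer.\<close>

lemma sum_mat_trace_subgroup:
  assumes \<rho>: "representation G d \<rho>" and H: "subgroup H G" "finite H"
  shows "\<exists>z::int. (\<Sum>h\<in>H. mat_trace (\<rho> h)) = of_nat (card H) * of_int z"
proof -
  interpret G: group G by (rule representationD(1)[OF \<rho>])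
  let ?c = "of_nat (card H) :: complex"
  have c: "?c \<noteq> 0"
    using H subgroup.one_closed[OF H(1)] by auto
  have HG: "h \<in> carrier G" if "h \<in> H" for h
    using subgroup.mem_carrier[OF H(1) that] .
  define P where "P = mat d d (\<lambda>(i, j). (\<Sum>h\<in>H. \<rho> h $$ (i, j)) / ?c)"
  have P: "P \<in> carrier_mat d d" by (simp add: P_def)
  have "P * P = P"
  proof (rule eq_matI)
    fix i j assume "i < dim_row P" "j < dim_col P"
    then have ij: "i < d" "j < d" using P by auto
    have "(P * P) $$ (i, j)
        = (\<Sum>k<d. ((\<Sum>h\<in>H. \<rho> h $$ (i, k)) / ?c) * ((\<Sum>h\<in>H. \<rho> h $$ (k, j)) / ?c))"
      using mat_mult_entry[OF P P ij] ij by (simp add: P_def)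
    also have "\<dots> = (\<Sum>k<d. \<Sum>h\<in>H. \<Sum>h'\<in>H. \<rho> h $$ (i, k) * \<rho> h' $$ (k, j)) / (?c * ?c)"
      by (simp add: sum_product sum_divide_distrib)
    also have "(\<Sum>k<d. \<Sum>h\<in>H. \<Sum>h'\<in>H. \<rho> h $$ (i, k) * \<rho> h' $$ (k, j))
        = (\<Sum>h\<in>H. \<Sum>k<d. \<Sum>h'\<in>H. \<rho> h $$ (i, k) * \<rho> h' $$ (k, j))"
      by (rule sum.swap)
    also have "\<dots> = (\<Sum>h\<in>H. \<Sum>h'\<in>H. \<Sum>k<d. \<rho> h $$ (i, k) * \<rho> h' $$ (k, j))"
      by (intro sum.cong refl sum.swap)
    also have "\<dots> = (\<Sum>h\<in>H. \<Sum>h'\<in>H. \<rho> (h \<otimes>\<^bsub>G\<^esub> h') $$ (i, j))"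
      using HG ij by (intro sum.cong refl) (simp add: representation_entry[OF \<rho>])
    also have "\<dots> = (\<Sum>h\<in>H. \<Sum>h'\<in>H. \<rho> h' $$ (i, j))"
    proof (rule sum.cong[OF refl])
      fix h assume h: "h \<in> H"
      show "(\<Sum>h'\<in>H. \<rho> (h \<otimes>\<^bsub>G\<^esub> h') $$ (i, j)) = (\<Sum>h'\<in>H. \<rho> h' $$ (i, j))"
        using h HG subgroup.m_closed[OF H(1)] subgroup.m_inv_closed[OF H(1)]
        by (intro sum.reindex_bij_witness[where i = "\<lambda>h'. inv\<^bsub>G\<^esub> h \<otimes>\<^bsub>G\<^esub> h'" and j = "\<lambda>h'. h \<otimes>\<^bsub>G\<^esub> h'"])
          (auto simp flip: G.m_assoc)
    qed
    also have "\<dots> / (?c * ?c) = P $$ (i, j)"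
      using c ij by (simp add: P_def)
    finally show "(P * P) $$ (i, j) = P $$ (i, j)" .
  qed (use P in auto)
  then have "mat_trace P \<in> \<int>"
    by (rule mat_trace_idempotent[OF P])
  then obtain z where z: "mat_trace P = of_int z"
    by (auto elim: Ints_cases)
  have "(\<Sum>h\<in>H. mat_trace (\<rho> h)) = (\<Sum>h\<in>H. \<Sum>i<d. \<rho> h $$ (i, i))"
    using representationD(2)[OF \<rho> HG] by (intro sum.cong refl mat_trace_carrier) auto
  also have "\<dots> = (\<Sum>i<d. \<Sum>h\<in>H. \<rho> h $$ (i, i))"
    by (rule sum.swap)
  also have "\<dots> = ?c * mat_trace P"
    unfolding mat_trace_carrier[OF P] sum_distrib_left[of ?c] using c
    by (intro sum.cong refl) (simp add: P_def)
  finally show ?thesis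
    using z by auto
qed

section \<open>Schur's lemma and the norm of an irreducible character\<close>

text \<open>A complex matrix has an eigenvalue, and the eigenspace of an intertwiner is an invariant
  subspace; being nonzero, it is everything.\<close>

lemma schur_scalar:
  assumes irr: "irreducible_representation G d \<rho>" and A: "A \<in> carrier_mat d d"
    and comm: "\<And>x. x \<in> carrier G \<Longrightarrow> \<rho> x * A = A * \<rho> x"
  shows "\<exists>k. A = k \<cdot>\<^sub>m 1\<^sub>m d"
proof -
  have \<rho>: "representation G d \<rho>" and d: "d > 0"
    using irr by (auto simp: irreducible_representation_def)
  obtain k v where v: "eigenvector A v k"
    using spectrum_non_empty[OF A d] by (auto simp: spectrum_def eigenvalue_def)
  define W where "W = {w \<in> carrier_vec d. A *\<^sub>v w = k \<cdot>\<^sub>v w}"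
  have "submodule class_ring W (module_vec TYPE(complex) d)"
    using A by (intro submodule.intro vec_module)
      (auto simp: W_def module_vec_simps class_ring_simps mult_add_distrib_mat_vec[OF A]
        smult_add_distrib_vec mult_mat_vec[OF A] smult_smult_assoc mult.commute)
  then have "VectorSpace.subspace class_ring W (module_vec TYPE(complex) d)"
    by (intro VectorSpace.subspace.intro vec_vs)
  moreover have "\<rho> x *\<^sub>v w \<in> W" if x: "x \<in> carrier G" and w: "w \<in> W" for x w
  proof -
    note X = representationD(2)[OF \<rho> x]
    have w': "w \<in> carrier_vec d" "A *\<^sub>v w = k \<cdot>\<^sub>v w" using w by (auto simp: W_def)
    have "A *\<^sub>v (\<rho> x *\<^sub>v w) = (A * \<rho> x) *\<^sub>v w"
      using A X w' by simp
    also have "\<dots> = \<rho> x *\<^sub>v (A *\<^sub>v w)"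
      using A X w' by (simp flip: comm[OF x])
    also have "\<dots> = k \<cdot>\<^sub>v (\<rho> x *\<^sub>v w)"
      using X w' by (simp add: mult_mat_vec)
    finally show ?thesis using X w' by (simp add: W_def)
  qed
  ultimately have "invariant_subspace G d \<rho> W"
    by (simp add: invariant_subspace_def)
  then have "W = {0\<^sub>v d} \<or> W = carrier_vec d"
    using irr by (auto simp: irreducible_representation_def)
  moreover have "v \<in> W" "v \<noteq> 0\<^sub>v d"
    using v A by (auto simp: W_def eigenvector_def)
  ultimately have W: "W = carrier_vec d" by auto
  have "A = k \<cdot>\<^sub>m 1\<^sub>m d"
  proof (rule eq_matI)
    fix i j assume "i < dim_row (k \<cdot>\<^sub>m 1\<^sub>m d)" "j < dim_col (k \<cdot>\<^sub>m 1\<^sub>m d)"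
    then have ij: "i < d" "j < d" by auto
    have "unit_vec d j \<in> W"
      unfolding W by simp
    then have "A *\<^sub>v unit_vec d j = k \<cdot>\<^sub>v unit_vec d j"
      by (simp add: W_def)
    then have "(A *\<^sub>v unit_vec d j) $ i = (k \<cdot>\<^sub>v unit_vec d j) $ i"
      by (rule arg_cong)
    moreover have "(A *\<^sub>v unit_vec d j) $ i = A $$ (i, j)"
      using A ij by simp
    ultimately show "A $$ (i, j) = (k \<cdot>\<^sub>m 1\<^sub>m d) $$ (i, j)"
      using ij by simp
  qed (use A in auto)
  then show ?thesis ..
qed

text \<open>Averaging matrix units over the group gives intertwiners, which are scalar by Schur's
  lemma; traces determine the scalars. Inverses in place of complex conjugates make it unnecessary
  to pass to a unitary form.\<close>

lemma character_norm:
  assumes irr: "irreducible_representation G d \<rho>" and fin: "finite (carrier G)"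
  shows "(\<Sum>x\<in>carrier G. mat_trace (\<rho> x) * mat_trace (\<rho> (inv\<^bsub>G\<^esub> x))) = of_nat (card (carrier G))"
proof -
  have \<rho>: "representation G d \<rho>" and d: "d > 0"
    using irr by (auto simp: irreducible_representation_def)
  interpret G: group G by (rule representationD(1)[OF \<rho>])
  let ?I = "\<lambda>x. inv\<^bsub>G\<^esub> x"
  \<comment> \<open>\<open>A p q\<close> is the sum of \<open>\<rho> x * E * \<rho> (?I x)\<close>
    over the group, where \<open>E\<close> is the matrix unit at position
    \<open>(p, q)\<close>.\<close>
  define A where "A p q = mat d d (\<lambda>(i, j). \<Sum>x\<in>carrier G. \<rho> x $$ (i, p) * \<rho> (?I x) $$ (q, j))" for p q
  have A: "A p q \<in> carrier_mat d d" for p q by (simp add: A_def)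
  have "\<exists>k. A p q = k \<cdot>\<^sub>m 1\<^sub>m d" if pq: "p < d" "q < d" for p q
  proof (rule schur_scalar[OF irr A])
    fix y assume y: "y \<in> carrier G"
    note Y = representationD(2)[OF \<rho> y]
    show "\<rho> y * A p q = A p q * \<rho> y"
    proof (rule eq_matI)
      fix i j assume "i < dim_row (A p q * \<rho> y)" "j < dim_col (A p q * \<rho> y)"
      then have ij: "i < d" "j < d" using A[of p q] Y by auto
      have "(\<rho> y * A p q) $$ (i, j)
          = (\<Sum>k<d. \<rho> y $$ (i, k) * (\<Sum>x\<in>carrier G. \<rho> x $$ (k, p) * \<rho> (?I x) $$ (q, j)))"
        using mat_mult_entry[OF Y A ij] ij by (simp add: A_def)
      also have "\<dots> = (\<Sum>x\<in>carrier G. (\<Sum>k<d. \<rho> y $$ (i, k) * \<rho> x $$ (k, p)) * \<rho> (?I x) $$ (q, j))"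
        unfolding sum_distrib_left sum_distrib_right by (subst sum.swap) (simp add: mult.assoc)
      also have "\<dots> = (\<Sum>x\<in>carrier G. \<rho> (y \<otimes>\<^bsub>G\<^esub> x) $$ (i, p) * \<rho> (?I x) $$ (q, j))"
        using y ij pq by (intro sum.cong refl) (simp add: representation_entry[OF \<rho>])
      also have "\<dots> = (\<Sum>x\<in>carrier G. \<rho> x $$ (i, p) * \<rho> (?I x \<otimes>\<^bsub>G\<^esub> y) $$ (q, j))"
        using y by (intro sum.reindex_bij_witness[where i = "\<lambda>x. ?I y \<otimes>\<^bsub>G\<^esub> x" and j = "\<lambda>x. y \<otimes>\<^bsub>G\<^esub> x"])
          (auto simp: G.inv_mult_group G.m_assoc simp flip: G.m_assoc[of y] G.m_assoc[of "?I y"])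
      also have "\<dots> = (\<Sum>x\<in>carrier G. \<rho> x $$ (i, p) * (\<Sum>k<d. \<rho> (?I x) $$ (q, k) * \<rho> y $$ (k, j)))"
        using y ij pq by (intro sum.cong refl) (simp add: representation_entry[OF \<rho>])
      also have "\<dots> = (\<Sum>k<d. (\<Sum>x\<in>carrier G. \<rho> x $$ (i, p) * \<rho> (?I x) $$ (q, k)) * \<rho> y $$ (k, j))"
        unfolding sum_distrib_left sum_distrib_right by (subst sum.swap) (simp add: mult.assoc)
      also have "\<dots> = (A p q * \<rho> y) $$ (i, j)"
        using mat_mult_entry[OF A Y ij] ij by (simp add: A_def)
      finally show "(\<rho> y * A p q) $$ (i, j) = (A p q * \<rho> y) $$ (i, j)" .
    qed (use A[of p q] Y in auto)
  qed
  then obtain \<kappa> where \<kappa>: "\<And>p q. p < d \<Longrightarrow> q < d \<Longrightarrow> A p q = \<kappa> p q \<cdot>\<^sub>m 1\<^sub>m d"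
    by metis
  have diag: "\<kappa> p p * of_nat d = of_nat (card (carrier G))" if p: "p < d" for p
  proof -
    have "\<kappa> p p * of_nat d = (\<Sum>i<d. A p p $$ (i, i))"
      using \<kappa>[OF p p] by simp
    also have "\<dots> = (\<Sum>i<d. \<Sum>x\<in>carrier G. \<rho> (?I x) $$ (p, i) * \<rho> x $$ (i, p))"
      by (simp add: A_def mult.commute)
    also have "\<dots> = (\<Sum>x\<in>carrier G. \<rho> (?I x \<otimes>\<^bsub>G\<^esub> x) $$ (p, p))"
      using p by (subst sum.swap, intro sum.cong refl representation_entry[OF \<rho>, symmetric]) auto
    also have "\<dots> = of_nat (card (carrier G))"
      using p by (simp add: representationD(4)[OF \<rho>])
    finally show ?thesis .
  qed
  have "(\<Sum>x\<in>carrier G. mat_trace (\<rho> x) * mat_trace (\<rho> (?I x)))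
      = (\<Sum>x\<in>carrier G. \<Sum>p<d. \<Sum>q<d. \<rho> x $$ (p, p) * \<rho> (?I x) $$ (q, q))"
    by (intro sum.cong refl)
      (simp add: mat_trace_carrier[OF representationD(2)[OF \<rho>]] sum_product)
  also have "\<dots> = (\<Sum>p<d. \<Sum>x\<in>carrier G. \<Sum>q<d. \<rho> x $$ (p, p) * \<rho> (?I x) $$ (q, q))"
    by (rule sum.swap)
  \<comment> \<open>The sum over the group is entry \<open>(p, q)\<close> of \<open>A p q\<close>,
    which vanishes for \<open>p \<noteq> q\<close> because \<open>A p q\<close> is scalar.\<close>
  also have "\<dots> = (\<Sum>p<d. \<Sum>q<d. A p q $$ (p, q))"
    by (intro sum.cong refl) (subst sum.swap, simp add: A_def)
  also have "\<dots> = (\<Sum>p<d. \<Sum>q<d. if q = p then \<kappa> p p else 0)"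
    by (intro sum.cong refl) (auto simp: \<kappa>)
  also have "\<dots> = (\<Sum>p<d. \<kappa> p p)"
    by simp
  also have "\<dots> = (\<Sum>p<d. of_nat (card (carrier G)) / of_nat d)"
    using diag d by (intro sum.cong refl) (simp add: eq_divide_eq)
  finally show ?thesis
    using d by simp
qed

section \<open>Characters of the symmetric group\<close>

text \<open>A colouring of the cycles is a colouring of the points that is constant along
  \<open>g\<close>, and cycle lengths add up to numbers of points. In this form sums over
  \<open>g\<close> and over colourings can be exchanged.\<close>

lemma frob_orbits:
  assumes g: "g permutes X" and X: "finite X"
  shows "frob N card (Orbits.orbit g ` X) \<beta>
    = (\<Sum>c | c \<in> X \<rightarrow>\<^sub>E {..<N} \<and> (\<forall>x\<in>X. c (g x) = c x).
        alternant N (\<lambda>i. \<beta> i - int (card {x \<in> X. c x = i})))"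
  unfolding frob_def
proof (rule sum.reindex_bij_witness)
  note cyc = cycles_of_permutation[OF g X]
  let ?to = "\<lambda>c. \<lambda>x\<in>X. c (Orbits.orbit g x)"
  \<comment> \<open>An invariant colouring is constant on each orbit, so any chosen point gives the
    colour of its cycle.\<close>
  let ?from = "\<lambda>c. \<lambda>C\<in>Orbits.orbit g ` X. c (SOME x. x \<in> C)"
  have step: "Orbits.orbit g (g x) = Orbits.orbit g x" for x
    by (rule permutation_orbit_step[OF permutes_imp_permutation[OF X g]])
  have self: "x \<in> Orbits.orbit g x" for x
    by (rule permutation_self_in_orbit[OF permutes_imp_permutation[OF X g]])
  have sub: "y \<in> X" "Orbits.orbit g y = Orbits.orbit g x" if "x \<in> X" "y \<in> Orbits.orbit g x" for x y
    using permutes_orbit_subset[OF g that(1)] that orbit_cyclic_eq3[OF cyclic_on_orbit[OF g X] that(2)]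
    by auto
  show "?from (?to c) = c" if "c \<in> Orbits.orbit g ` X \<rightarrow>\<^sub>E {..<N}" for c
  proof
    fix C show "?from (?to c) C = c C"
    proof (cases "C \<in> Orbits.orbit g ` X")
      case True
      then obtain x where x: "x \<in> X" "C = Orbits.orbit g x" by blast
      have "(SOME y. y \<in> C) \<in> Orbits.orbit g x"
        using self[of x] x(2) by (metis someI_ex)
      then show ?thesis
        using sub[OF x(1)] x by simp
    next
      case False
      then show ?thesis using PiE_arb[OF that False] by (simp only: restrict_apply if_False)
    qed
  qed
  show "?to c \<in> {c. c \<in> X \<rightarrow>\<^sub>E {..<N} \<and> (\<forall>x\<in>X. c (g x) = c x)}"
    if "c \<in> Orbits.orbit g ` X \<rightarrow>\<^sub>E {..<N}" for c
    using that permutes_in_image[OF g] by (auto simp: step PiE_iff)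
  show "?to (?from c) = c" if c: "c \<in> {c. c \<in> X \<rightarrow>\<^sub>E {..<N} \<and> (\<forall>x\<in>X. c (g x) = c x)}" for c
  proof
    fix x show "?to (?from c) x = c x"
    proof (cases "x \<in> X")
      case True
      have inv: "c y = c x" if "y \<in> Orbits.orbit g x" for y
        using that
      proof induction
        case base
        then show ?case using c True by simp
      next
        case (step y)
        then show ?case using c sub(1)[OF True, of y] by simp
      qed
      have "(SOME y. y \<in> Orbits.orbit g x) \<in> Orbits.orbit g x"
        using self[of x] by (rule someI)
      then show ?thesis using True inv by simp
    next
      case False
      then show ?thesis using c PiE_arb[of c X "\<lambda>_. {..<N}" x] by simp
    qed
  qed
  show "?from c \<in> Orbits.orbit g ` X \<rightarrow>\<^sub>E {..<N}" if c: "c \<in> {c. c \<in> X \<rightarrow>\<^sub>E {..<N} \<and> (\<forall>x\<in>X. c (g x) = c x)}" for c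
  proof (rule PiE_I)
    fix C assume C: "C \<in> Orbits.orbit g ` X"
    then obtain x where x: "x \<in> X" "C = Orbits.orbit g x" by blast
    have "(SOME y. y \<in> C) \<in> Orbits.orbit g x"
      using self[of x] x(2) by (metis someI_ex)
    then have "(SOME y. y \<in> C) \<in> X" using sub[OF x(1)] by blast
    then show "?from c C \<in> {..<N}" using C c by (auto simp: PiE_iff)
  qed simp
  show "alternant N (\<lambda>i. \<beta> i - int (card {x \<in> X. ?to c x = i}))
      = alternant N (\<lambda>i. \<beta> i - int (colour_content card (Orbits.orbit g ` X) c i))"
    if "c \<in> Orbits.orbit g ` X \<rightarrow>\<^sub>E {..<N}" for c
  proof -
    have "card {x \<in> X. ?to c x = i} = colour_content card (Orbits.orbit g ` X) c i" for i
    proof -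
      have "{x \<in> X. ?to c x = i} = \<Union>{C \<in> Orbits.orbit g ` X. c C = i}"
      proof (intro equalityI subsetI)
        fix x assume "x \<in> {x \<in> X. ?to c x = i}"
        then show "x \<in> \<Union>{C \<in> Orbits.orbit g ` X. c C = i}"
          using self[of x] by (intro UnionI[of "Orbits.orbit g x"]) auto
      next
        fix x assume "x \<in> \<Union>{C \<in> Orbits.orbit g ` X. c C = i}"
        then obtain y where "y \<in> X" "x \<in> Orbits.orbit g y" "c (Orbits.orbit g y) = i" by blast
        then show "x \<in> {x \<in> X. ?to c x = i}"
          using sub[of y x] by simp
      qed
      moreover have "card (\<Union>{C \<in> Orbits.orbit g ` X. c C = i}) = sum card {C \<in> Orbits.orbit g ` X. c C = i}"
      proof (intro card_Union_disjoint pairwiseI)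
        show "disjnt A B" if "A \<in> {C \<in> Orbits.orbit g ` X. c C = i}"
          "B \<in> {C \<in> Orbits.orbit g ` X. c C = i}" "A \<noteq> B" for A B
          using cyclic_on_disjoint[OF cyc(3) cyc(3), of A B] that unfolding disjnt_def by blast
        show "finite A" if "A \<in> {C \<in> Orbits.orbit g ` X. c C = i}" for A
          using finite_cyclic_on[OF cyc(3), of A] that by blast
      qed
      ultimately show ?thesis by (simp add: colour_content_def)
    qed
    then show ?thesis by simp
  qed
qed

text \<open>Summing over the colourings of a fixed content amounts to inducing from a Young subgroup, and
  the double count of pairs (permutation, colouring) below is Frobenius reciprocity.\<close>

lemma sum_stabilizers_of_content:
  fixes \<chi> :: "('a \<Rightarrow> 'a) \<Rightarrow> complex" and c0 :: "'a \<Rightarrow> nat"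
  assumes X: "finite X"
    and class_fun: "\<And>x y. x permutes X \<Longrightarrow> y permutes X \<Longrightarrow> \<chi> (x \<circ> y) = \<chi> (y \<circ> x)"
    and c0: "c0 \<in> X \<rightarrow>\<^sub>E {..<N}"
  shows "of_nat (card {g. g permutes X \<and> (\<forall>x\<in>X. c0 (g x) = c0 x)}) *
     (\<Sum>c | c \<in> X \<rightarrow>\<^sub>E {..<N} \<and> (\<lambda>i. card {x \<in> X. c x = i}) = (\<lambda>i. card {x \<in> X. c0 x = i}).
        \<Sum>g | g permutes X \<and> (\<forall>x\<in>X. c (g x) = c x). \<chi> g)
   = fact (card X) * (\<Sum>g | g permutes X \<and> (\<forall>x\<in>X. c0 (g x) = c0 x). \<chi> g)"
proof -
  let ?G = "{g. g permutes X}"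
  let ?stab = "\<lambda>c. {g. g permutes X \<and> (\<forall>x\<in>X. c (g x) = c x)}"
  let ?R = "\<lambda>c. \<Sum>g\<in>?stab c. \<chi> g"
  let ?cls = "{c. c \<in> X \<rightarrow>\<^sub>E {..<N} \<and> (\<lambda>i. card {x \<in> X. c x = i}) = (\<lambda>i. card {x \<in> X. c0 x = i})}"
  \<comment> \<open>Permutations act on colourings by precomposition; the sum of
    \<open>?R (?act p)\<close> over all \<open>p\<close> is evaluated in two ways.\<close>
  let ?act = "\<lambda>p. \<lambda>x\<in>X. c0 (p x)"
  have finG: "finite ?G" using X by (rule finite_permutations)
  have fincls: "finite ?cls"
    by (rule finite_subset[OF _ finite_PiE[OF X, of "\<lambda>_. {..<N}"]]) auto
  have act: "?act p \<in> ?cls" if p: "p permutes X" for p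
  proof -
    have "card {x \<in> X. ?act p x = i} = card {x \<in> X. c0 x = i}" for i
    proof (rule bij_betw_same_card)
      show "bij_betw p {x \<in> X. ?act p x = i} {x \<in> X. c0 x = i}"
        using permutes_in_image[OF p] permutes_inj[OF p] permutes_surj[OF p]
        by (auto simp: bij_betw_def inj_on_def image_iff) (metis surjD)
    qed
    then show ?thesis
      using c0 permutes_in_image[OF p] by (auto simp: PiE_iff)
  qed
  \<comment> \<open>The stabilizers of \<open>c0\<close> and \<open>?act p\<close> are conjugate
    under \<open>p\<close>, and a class function has the same sum over both.\<close>
  have R: "?R (?act p) = ?R c0" if p: "p permutes X" for p
  proof (rule sum.reindex_bij_witness[where i = "\<lambda>g. inv' p \<circ> g \<circ> p" and j = "\<lambda>g. p \<circ> g \<circ> inv' p"])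
    note invp = permutes_inv[OF p] and io = permutes_inv_o[OF p]
    have inv1: "inv' p (p x) = x" "p (inv' p x) = x" for x
      using permutes_inverses[OF p] by auto
    fix g assume g: "g \<in> ?stab (?act p)"
    show "inv' p \<circ> (p \<circ> g \<circ> inv' p) \<circ> p = g" by (simp add: fun_eq_iff inv1)
    show "p \<circ> g \<circ> inv' p \<in> ?stab c0"
    proof (intro CollectI conjI ballI)
      show "p \<circ> g \<circ> inv' p permutes X" using g p invp by (auto intro: permutes_compose)
      fix x assume "x \<in> X"
      then have y: "inv' p x \<in> X" using permutes_in_image[OF invp] by simp
      moreover have "g (inv' p x) \<in> X" using g y permutes_in_image[of g X] by simp
      ultimately show "c0 ((p \<circ> g \<circ> inv' p) x) = c0 x"
        using g by (auto simp: inv1 dest!: bspec[OF _ y])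
    qed
    have "\<chi> (p \<circ> g \<circ> inv' p) = \<chi> (inv' p \<circ> (p \<circ> g))"
      using g p invp by (intro class_fun) (auto intro: permutes_compose)
    then show "\<chi> (p \<circ> g \<circ> inv' p) = \<chi> g"
      by (simp add: comp_assoc[symmetric] io)
  next
    note invp = permutes_inv[OF p]
    have inv1: "inv' p (p x) = x" "p (inv' p x) = x" for x
      using permutes_inverses[OF p] by auto
    fix g assume g: "g \<in> ?stab c0"
    show "p \<circ> (inv' p \<circ> g \<circ> p) \<circ> inv' p = g" by (simp add: fun_eq_iff inv1)
    show "inv' p \<circ> g \<circ> p \<in> ?stab (?act p)"
    proof (intro CollectI conjI ballI)
      show perm: "inv' p \<circ> g \<circ> p permutes X" using g p invp by (auto intro: permutes_compose)
      fix x assume x: "x \<in> X"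
      then have "p x \<in> X" using permutes_in_image[OF p] by simp
      then show "?act p ((inv' p \<circ> g \<circ> p) x) = ?act p x"
        using g x permutes_in_image[OF perm, of x] by (simp add: inv1)
    qed
  qed
  \<comment> \<open>Colourings with equal content differ by a permutation \<open>p\<close>, and the
    permutations producing \<open>c\<close> form the coset of all \<open>g \<circ> p\<close> with
    \<open>g\<close> stabilizing \<open>c0\<close>.\<close>
  have fibre: "card {p \<in> ?G. ?act p = c} = card (?stab c0)" if c: "c \<in> ?cls" for c
  proof -
    have "image_mset c (mset_set X) = image_mset c0 (mset_set X)"
    proof (rule multiset_eqI)
      fix i
      have "card {x \<in> X. c x = i} = card {x \<in> X. c0 x = i}"
        using c by (auto dest: fun_cong)
      moreover have "{x \<in> X. f x = i} = f -` {i} \<inter> X" for f :: "'a \<Rightarrow> nat" by auto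
      ultimately show "count (image_mset c (mset_set X)) i = count (image_mset c0 (mset_set X)) i"
        using X by (simp add: count_image_mset)
    qed
    then obtain p where p: "p permutes X" "\<forall>x\<in>X. c x = c0 (p x)"
      using image_mset_eq_implies_permutes[OF X] by metis
    have inv1: "inv' p (p x) = x" "p (inv' p x) = x" for x
      using permutes_inverses[OF p(1)] by auto
    note invp = permutes_inv[OF p(1)]
    have c_out: "c x = undefined" if "x \<notin> X" for x
      using c that by (auto simp: PiE_iff extensional_def)
    have act_eq: "?act q = c \<longleftrightarrow> (\<forall>x\<in>X. c0 (q x) = c0 (p x))" for q
      using p(2) c_out by (auto simp: fun_eq_iff)
    have "bij_betw (\<lambda>g. g \<circ> p) (?stab c0) {q \<in> ?G. ?act q = c}"
    proof (rule bij_betw_byWitness[where f' = "\<lambda>q. q \<circ> inv' p"])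
      show "(\<lambda>g. g \<circ> p) ` ?stab c0 \<subseteq> {q \<in> ?G. ?act q = c}"
        unfolding act_eq using p(1) permutes_in_image[OF p(1)] by (auto intro: permutes_compose)
      show "(\<lambda>q. q \<circ> inv' p) ` {q \<in> ?G. ?act q = c} \<subseteq> ?stab c0"
        unfolding act_eq using invp permutes_in_image[OF invp]
        by (auto intro: permutes_compose simp: inv1)
    qed (auto simp: fun_eq_iff inv1)
    then show ?thesis by (simp add: bij_betw_same_card)
  qed
  have "of_nat (card (?stab c0)) * (\<Sum>c\<in>?cls. ?R c) = (\<Sum>c\<in>?cls. \<Sum>p\<in>{p \<in> ?G. ?act p = c}. ?R c)"
    using fibre by (simp add: sum_distrib_left)
  also have "\<dots> = (\<Sum>c\<in>?cls. \<Sum>p\<in>{p \<in> ?G. ?act p = c}. ?R (?act p))"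
    by (intro sum.cong refl) auto
  also have "\<dots> = (\<Sum>p\<in>?G. ?R (?act p))"
    using act by (intro sum.group[OF finG fincls]) blast
  also have "\<dots> = (\<Sum>p\<in>?G. ?R c0)"
    by (rule sum.cong[OF refl], rule R, simp)
  also have "\<dots> = fact (card X) * ?R c0"
    using card_permutations[OF refl X] by simp
  finally show ?thesis .
qed

text \<open>Each \<open>x\<close> conjugates exactly one \<open>g\<close> to \<open>h\<close>,
  namely \<open>inv' x \<circ> (h \<circ> x)\<close>, and \<open>\<chi>\<close> has the value
  \<open>\<chi> h\<close> there.\<close>

lemma sum_class_function_conjugators:
  fixes \<chi> :: "('a \<Rightarrow> 'a) \<Rightarrow> complex"
  assumes X: "finite X" and h: "h permutes X"
    and class_fun: "\<And>x y. x permutes X \<Longrightarrow> y permutes X \<Longrightarrow> \<chi> (x \<circ> y) = \<chi> (y \<circ> x)"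
  shows "(\<Sum>g | g permutes X. \<chi> g * of_nat (card {x. x permutes X \<and> x \<circ> g = h \<circ> x}))
       = fact (card X) * \<chi> h"
proof -
  let ?G = "{g. g permutes X}"
  have finG: "finite ?G" using X by (rule finite_permutations)
  have "(\<Sum>g\<in>?G. \<chi> g * of_nat (card {x. x permutes X \<and> x \<circ> g = h \<circ> x}))
      = (\<Sum>g\<in>?G. \<Sum>x\<in>?G. if x \<circ> g = h \<circ> x then \<chi> g else 0)"
  proof (rule sum.cong[OF refl])
    fix g
    have "(\<Sum>x\<in>?G. if x \<circ> g = h \<circ> x then \<chi> g else 0) = (\<Sum>x\<in>{x \<in> ?G. x \<circ> g = h \<circ> x}. \<chi> g)"
      using finG by (intro sum.inter_filter[symmetric])
    then show "\<chi> g * of_nat (card {x. x permutes X \<and> x \<circ> g = h \<circ> x})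
        = (\<Sum>x\<in>?G. if x \<circ> g = h \<circ> x then \<chi> g else 0)"
      by (simp add: mult.commute)
  qed
  also have "\<dots> = (\<Sum>x\<in>?G. \<Sum>g\<in>?G. if x \<circ> g = h \<circ> x then \<chi> g else 0)"
    by (rule sum.swap)
  also have "\<dots> = (\<Sum>x\<in>?G. \<chi> h)"
  proof (rule sum.cong[OF refl])
    fix x assume "x \<in> ?G"
    then have x: "x permutes X" by simp
    have eq: "x \<circ> g = h \<circ> x \<longleftrightarrow> g = inv' x \<circ> (h \<circ> x)" for g
      using permutes_inv_o[OF x] by (metis comp_assoc comp_id id_comp)
    have mem: "inv' x \<circ> (h \<circ> x) \<in> ?G"
      using x h permutes_inv[OF x] by (auto intro: permutes_compose)
    have "(\<Sum>g\<in>?G. if x \<circ> g = h \<circ> x then \<chi> g else 0)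
        = (\<Sum>g\<in>?G. if g = inv' x \<circ> (h \<circ> x) then \<chi> (inv' x \<circ> (h \<circ> x)) else 0)"
      unfolding eq by (intro sum.cong) auto
    also have "\<dots> = \<chi> (inv' x \<circ> (h \<circ> x))"
      using mem finG by simp
    also have "\<dots> = \<chi> ((h \<circ> x) \<circ> inv' x)"
      using x h permutes_inv[OF x] by (intro class_fun) (auto intro: permutes_compose)
    also have "\<dots> = \<chi> h"
      using permutes_inv_o(1)[OF x] by (simp add: comp_assoc)
    finally show "(\<Sum>g\<in>?G. if x \<circ> g = h \<circ> x then \<chi> g else 0) = \<chi> h" .
  qed
  also have "\<dots> = fact (card X) * \<chi> h"
    using card_permutations[OF refl X] by simp
  finally show ?thesis .
qed

section \<open>Integrality, expansion and the bound for class functions\<close>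

text \<open>After exchanging sums, colourings are grouped by content: the alternant value depends on
  the content alone, and each group adds up to \<open>fact (card X)\<close> times an integer. The
  hypothesis \<open>stab\<close> says that \<open>\<chi>\<close> has integral inner products with
  the permutation characters on cosets of Young subgroups.\<close>

lemma sum_frob_orbits_multiple:
  fixes \<chi> :: "('a \<Rightarrow> 'a) \<Rightarrow> complex"
  assumes X: "finite X"
    and class_fun: "\<And>x y. x permutes X \<Longrightarrow> y permutes X \<Longrightarrow> \<chi> (x \<circ> y) = \<chi> (y \<circ> x)"
    and stab: "\<And>c :: 'a \<Rightarrow> nat. \<exists>z::int. (\<Sum>g | g permutes X \<and> (\<forall>x\<in>X. c (g x) = c x). \<chi> g)
        = of_nat (card {g. g permutes X \<and> (\<forall>x\<in>X. c (g x) = c x)}) * of_int z"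
  shows "\<exists>z::int. (\<Sum>g | g permutes X. \<chi> g * of_int (frob N card (Orbits.orbit g ` X) \<beta>))
       = fact (card X) * of_int z"
proof -
  let ?G = "{g. g permutes X}" and ?C = "X \<rightarrow>\<^sub>E {..<N}"
  let ?cnt = "\<lambda>(c :: 'a \<Rightarrow> nat) i. card {x \<in> X. c x = i}"
  let ?stab = "\<lambda>c :: 'a \<Rightarrow> nat. {g. g permutes X \<and> (\<forall>x\<in>X. c (g x) = c x)}"
  let ?A = "\<lambda>\<alpha>. alternant N (\<lambda>i. \<beta> i - int (\<alpha> i))"
  let ?R = "\<lambda>c. \<Sum>g\<in>?stab c. \<chi> g"
  have finG: "finite ?G" using X by (rule finite_permutations)
  have finC: "finite ?C" by (intro finite_PiE X) auto
  have "\<forall>\<alpha>\<in>?cnt ` ?C. \<exists>z::int.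
      (\<Sum>c | c \<in> ?C \<and> ?cnt c = \<alpha>. ?R c) = fact (card X) * of_int z"
  proof
    fix \<alpha> assume \<alpha>: "\<alpha> \<in> ?cnt ` ?C"
    obtain c0 where c0: "\<alpha> = ?cnt c0" "c0 \<in> ?C" using \<alpha> by (rule imageE)
    obtain z :: int where z: "?R c0 = of_nat (card (?stab c0)) * of_int z"
      using stab[of c0] by blast
    have "id \<in> ?stab c0" by (simp add: permutes_id)
    moreover have "finite (?stab c0)" using finG by (rule finite_subset[rotated]) auto
    ultimately have "card (?stab c0) \<noteq> 0" unfolding card_eq_0_iff by blast
    then have nz: "(of_nat (card (?stab c0)) :: complex) \<noteq> 0" by (simp only: of_nat_eq_0_iff not_False_eq_True)
    have "of_nat (card (?stab c0)) * (\<Sum>c | c \<in> ?C \<and> ?cnt c = \<alpha>. ?R c)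
        = of_nat (card (?stab c0)) * (fact (card X) * of_int z)"
      using sum_stabilizers_of_content[where \<chi> = \<chi>, OF X class_fun c0(2)] unfolding c0(1) z
      by (simp only: mult.left_commute)
    then have "(\<Sum>c | c \<in> ?C \<and> ?cnt c = \<alpha>. ?R c) = fact (card X) * of_int z"
      using nz by (simp only: mult_cancel_left) blast
    then show "\<exists>z::int. (\<Sum>c | c \<in> ?C \<and> ?cnt c = \<alpha>. ?R c) = fact (card X) * of_int z" ..
  qed
  from bchoice[OF this] obtain z :: "(nat \<Rightarrow> nat) \<Rightarrow> int" where "\<forall>\<alpha>\<in>?cnt ` ?C.
      (\<Sum>c | c \<in> ?C \<and> ?cnt c = \<alpha>. ?R c) = fact (card X) * of_int (z \<alpha>)" ..
  note z = bspec[OF this]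
  have "(\<Sum>g\<in>?G. \<chi> g * of_int (frob N card (Orbits.orbit g ` X) \<beta>))
      = (\<Sum>g\<in>?G. \<Sum>c\<in>?C. if \<forall>x\<in>X. c (g x) = c x then of_int (?A (?cnt c)) * \<chi> g else 0)"
  proof (rule sum.cong[OF refl])
    fix g assume "g \<in> ?G"
    then have "frob N card (Orbits.orbit g ` X) \<beta>
        = (\<Sum>c\<in>{c \<in> ?C. \<forall>x\<in>X. c (g x) = c x}. ?A (?cnt c))"
      using frob_orbits[OF _ X] by simp
    then have "\<chi> g * of_int (frob N card (Orbits.orbit g ` X) \<beta>)
        = (\<Sum>c\<in>{c \<in> ?C. \<forall>x\<in>X. c (g x) = c x}. of_int (?A (?cnt c)) * \<chi> g)"
      by (simp only: of_int_sum sum_distrib_left mult.commute)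
    then show "\<chi> g * of_int (frob N card (Orbits.orbit g ` X) \<beta>)
        = (\<Sum>c\<in>?C. if \<forall>x\<in>X. c (g x) = c x then of_int (?A (?cnt c)) * \<chi> g else 0)"
      by (simp only: sum.inter_filter[OF finC])
  qed
  also have "\<dots> = (\<Sum>c\<in>?C. \<Sum>g\<in>?G. if \<forall>x\<in>X. c (g x) = c x then of_int (?A (?cnt c)) * \<chi> g else 0)"
    by (rule sum.swap)
  also have "\<dots> = (\<Sum>c\<in>?C. of_int (?A (?cnt c)) * ?R c)"
  proof (rule sum.cong[OF refl])
    fix c
    have "?stab c = {g \<in> ?G. \<forall>x\<in>X. c (g x) = c x}" by simp
    then show "(\<Sum>g\<in>?G. if \<forall>x\<in>X. c (g x) = c x then of_int (?A (?cnt c)) * \<chi> g else 0)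
        = of_int (?A (?cnt c)) * ?R c"
      by (simp only: sum.inter_filter[OF finG, symmetric] sum_distrib_left)
  qed
  also have "\<dots> = (\<Sum>\<alpha>\<in>?cnt ` ?C. \<Sum>c | c \<in> ?C \<and> ?cnt c = \<alpha>. of_int (?A (?cnt c)) * ?R c)"
    by (rule sum.image_gen[OF finC])
  also have "\<dots> = (\<Sum>\<alpha>\<in>?cnt ` ?C. of_int (?A \<alpha>) * (\<Sum>c | c \<in> ?C \<and> ?cnt c = \<alpha>. ?R c))"
    unfolding sum_distrib_left[of "of_int _"] by (intro sum.cong refl) auto
  also have "\<dots> = (\<Sum>\<alpha>\<in>?cnt ` ?C. fact (card X) * of_int (?A \<alpha> * z \<alpha>))"
    using z by (intro sum.cong refl) (simp only: of_int_mult mult.left_commute)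
  also have "\<dots> = fact (card X) * of_int (\<Sum>\<alpha>\<in>?cnt ` ?C. ?A \<alpha> * z \<alpha>)"
    by (simp only: of_int_sum sum_distrib_left)
  finally show ?thesis by blast
qed

text \<open>Summing over \<open>\<beta>\<close> first turns the product of coefficients into
  \<open>frob_pairing\<close>, which counts the conjugators of \<open>g\<close> to
  \<open>h\<close>.\<close>

lemma frob_reproducing:
  fixes \<chi> :: "('a \<Rightarrow> 'a) \<Rightarrow> complex"
  assumes X: "finite X" and h: "h permutes X"
    and class_fun: "\<And>x y. x permutes X \<Longrightarrow> y permutes X \<Longrightarrow> \<chi> (x \<circ> y) = \<chi> (y \<circ> x)"
    and N: "card X \<le> N" and M: "N + card X \<le> M"
  shows "(\<Sum>\<beta>\<in>box N M. (\<Sum>g | g permutes X. \<chi> g * of_int (frob N card (Orbits.orbit g ` X) \<beta>))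
            * of_int (frob N card (Orbits.orbit h ` X) \<beta>))
       = fact N * fact (card X) * \<chi> h"
proof -
  have "(\<Sum>\<beta>\<in>box N M. (\<Sum>g | g permutes X. \<chi> g * of_int (frob N card (Orbits.orbit g ` X) \<beta>))
            * of_int (frob N card (Orbits.orbit h ` X) \<beta>))
      = (\<Sum>g | g permutes X. \<chi> g * of_int (frob_pairing N M card (Orbits.orbit g ` X) card (Orbits.orbit h ` X)))"
    unfolding sum_distrib_right frob_pairing_def of_int_sum of_int_mult sum_distrib_left
    by (subst sum.swap) (simp only: mult.assoc)
  also have "\<dots> = (\<Sum>g | g permutes X.
      fact N * (\<chi> g * of_nat (card {x. x permutes X \<and> x \<circ> g = h \<circ> x})))"
    using frob_pairing_permutes[OF _ h X N M] by (intro sum.cong refl) simp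
  also have "\<dots> = fact N * fact (card X) * \<chi> h"
    using sum_class_function_conjugators[where \<chi> = \<chi>, OF X h class_fun] by (simp flip: sum_distrib_left)
  finally show ?thesis .
qed

text \<open>The hypotheses retain three facts about an irreducible character: it is a class
  function, its inner products with the Young permutation characters are integers, and its norm is
  one.\<close>

lemma class_function_bound:
  fixes \<chi> :: "('a \<Rightarrow> 'a) \<Rightarrow> complex"
  assumes X: "finite X" and h: "h permutes X"
    and class_fun: "\<And>x y. x permutes X \<Longrightarrow> y permutes X \<Longrightarrow> \<chi> (x \<circ> y) = \<chi> (y \<circ> x)"
    and stab: "\<And>c :: 'a \<Rightarrow> nat. \<exists>z::int. (\<Sum>g | g permutes X \<and> (\<forall>x\<in>X. c (g x) = c x). \<chi> g)
        = of_nat (card {g. g permutes X \<and> (\<forall>x\<in>X. c (g x) = c x)}) * of_int z"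
    and norm: "(\<Sum>g | g permutes X. \<chi> g * \<chi> (inv' g)) = fact (card X)"
  shows "cmod (\<chi> h) \<le> fact (card (Orbits.orbit h ` X))"
proof -
  define n where "n = card X"
  \<comment> \<open>\<open>n\<close> variables and entries below \<open>n + n\<close> are the least
    values that \<open>frob_reproducing\<close> permits.\<close>
  let ?G = "{g. g permutes X}" and ?B = "box n (n + n)"
  let ?F = "\<lambda>g. frob n card (Orbits.orbit g ` X)"
  have "\<exists>z::int. (\<Sum>g\<in>?G. \<chi> g * of_int (?F g \<beta>)) = fact n * of_int z" for \<beta>
    unfolding n_def by (rule sum_frob_orbits_multiple[where \<chi> = \<chi>, OF X class_fun stab])
  then obtain z :: "(nat \<Rightarrow> int) \<Rightarrow> int"
    where z: "\<And>\<beta>. (\<Sum>g\<in>?G. \<chi> g * of_int (?F g \<beta>)) = fact n * of_int (z \<beta>)"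
    by metis
  have repr: "(\<Sum>\<beta>\<in>?B. of_int (z \<beta>) * of_int (?F x \<beta>)) = fact n * \<chi> x" if "x permutes X" for x
  proof -
    have "fact n * (\<Sum>\<beta>\<in>?B. of_int (z \<beta>) * of_int (?F x \<beta>)) = fact n * (fact n * \<chi> x)"
      using frob_reproducing[where \<chi> = \<chi>, OF X that class_fun, of n "n + n"] z
      by (simp add: n_def sum_distrib_left mult.assoc)
    then show ?thesis by simp
  qed
  \<comment> \<open>Inversion keeps the cycles, so \<open>z\<close> is unchanged when
    \<open>\<chi>\<close> is evaluated at inverses; this replaces complex conjugation in the
    norm.\<close>
  have orb: "Orbits.orbit (inv' g) = Orbits.orbit g" if "g permutes X" for g
    using orbit_inv_eq[OF permutes_imp_permutation[OF X that]] by blast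
  have "(\<Sum>g\<in>?G. \<chi> (inv' g) * of_int (?F g \<beta>)) = (\<Sum>g\<in>?G. \<chi> g * of_int (?F g \<beta>))" for \<beta>
    by (rule sum.reindex_bij_witness[where i = "inv'" and j = "inv'"])
      (auto simp: permutes_inv permutes_inv_inv orb)
  then have z_inv: "(\<Sum>g\<in>?G. \<chi> (inv' g) * of_int (?F g \<beta>)) = fact n * of_int (z \<beta>)" for \<beta>
    by (simp only: z)
  \<comment> \<open>Parseval's identity: one factor \<open>z \<beta>\<close> is expanded by
    \<open>z_inv\<close>, and \<open>repr\<close> then leaves the norm of
    \<open>\<chi>\<close>.\<close>
  have "fact n * (\<Sum>\<beta>\<in>?B. of_int (z \<beta>) * of_int (z \<beta>))
      = (\<Sum>\<beta>\<in>?B. of_int (z \<beta>) * (\<Sum>g\<in>?G. \<chi> (inv' g) * of_int (?F g \<beta>)))"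
    by (simp only: z_inv sum_distrib_left mult.left_commute)
  also have "\<dots> = (\<Sum>g\<in>?G. \<chi> (inv' g) * (\<Sum>\<beta>\<in>?B. of_int (z \<beta>) * of_int (?F g \<beta>)))"
    unfolding sum_distrib_left by (subst sum.swap) (simp only: mult.left_commute)
  also have "\<dots> = (\<Sum>g\<in>?G. fact n * (\<chi> g * \<chi> (inv' g)))"
    using repr by (intro sum.cong refl) simp
  also have "\<dots> = fact n * fact n"
    using norm by (simp add: n_def flip: sum_distrib_left)
  finally have "(\<Sum>\<beta>\<in>?B. of_int (z \<beta>) * of_int (z \<beta>)) = (fact n :: complex)"
    by simp
  then have "of_int (\<Sum>\<beta>\<in>?B. z \<beta> * z \<beta>) = (of_int (fact n) :: complex)"
    by (simp only: of_int_sum of_int_mult of_int_fact)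
  then have sq: "(\<Sum>\<beta>\<in>?B. z \<beta> * z \<beta>) = fact n"
    by (simp only: of_int_eq_iff)
  let ?k = "card (Orbits.orbit h ` X)"
  note cyc = cycles_of_permutation[OF h X]
  have "fact n * \<chi> h = of_int (\<Sum>\<beta>\<in>?B. z \<beta> * ?F h \<beta>)"
    using repr[OF h] by simp
  then have "cmod (fact n * \<chi> h) = cmod (of_int (\<Sum>\<beta>\<in>?B. z \<beta> * ?F h \<beta>))"
    by (rule arg_cong)
  then have "fact n * cmod (\<chi> h) = of_int \<bar>\<Sum>\<beta>\<in>?B. z \<beta> * ?F h \<beta>\<bar>"
    by (simp only: norm_mult norm_fact norm_of_int of_int_abs)
  also have "\<bar>\<Sum>\<beta>\<in>?B. z \<beta> * ?F h \<beta>\<bar> \<le> (\<Sum>\<beta>\<in>?B. \<bar>z \<beta> * ?F h \<beta>\<bar>)"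
    by (rule sum_abs)
  also have "\<dots> \<le> (\<Sum>\<beta>\<in>?B. z \<beta> * z \<beta> * fact ?k)"
  proof (rule sum_mono)
    fix \<beta>
    \<comment> \<open>Integrality enters here: a nonzero integer has absolute value at least 1, so
      the first power of \<open>z\<close> is controlled by the known sum of squares.\<close>
    have "\<bar>z \<beta>\<bar> \<le> z \<beta> * z \<beta>"
      using mult_left_mono[of 1 "\<bar>z \<beta>\<bar>" "\<bar>z \<beta>\<bar>"] by (cases "z \<beta> = 0") auto
    moreover have "\<bar>?F h \<beta>\<bar> \<le> fact ?k"
      using abs_frob_le[OF cyc(1), of card n \<beta>] cyclic_on_card_pos[OF cyc(3)] by blast
    ultimately show "\<bar>z \<beta> * ?F h \<beta>\<bar> \<le> z \<beta> * z \<beta> * fact ?k"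
      unfolding abs_mult by (intro mult_mono) auto
  qed
  also have "\<dots> = fact n * fact ?k"
    unfolding sum_distrib_right[symmetric] sq ..
  finally have "fact n * cmod (\<chi> h) \<le> fact n * fact ?k"
    by (simp add: of_int_le_iff)
  then show ?thesis by simp
qed

section \<open>Specialization to \<open>sym_group n\<close>\<close>

text \<open>In a finite group the subgroup generated by \<open>g\<close> consists of its natural
  powers, which are the iterates that make up \<open>Orbits.orbit\<close>.\<close>

lemma cyclic_orbits_eq:
  assumes "g \<in> carrier (sym_group n)"
  shows "cyclic_orbits n g = Orbits.orbit g ` {1..n}"
proof -
  interpret group "sym_group n" by (rule sym_group_is_group)
  have g: "g permutes {1..n}" using assms by (simp add: sym_group_carrier)
  have pow: "g [^]\<^bsub>sym_group n\<^esub> k = g ^^ k" for k :: nat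
    by (induction k) (simp_all add: sym_group_one sym_group_mult funpow_Suc_right del: funpow.simps)
  have "finite (carrier (sym_group n))"
    by (simp add: sym_group_def finite_permutations)
  then have "generate (sym_group n) {g} = range (\<lambda>k. g ^^ k)"
    using generate_pow_on_finite_carrier[OF _ assms] pow by auto
  moreover have "Orbits.orbit g x = {(g ^^ k) x | k. True}" for x
    by (rule orbit_altdef_permutation[OF permutes_imp_permutation[OF _ g]]) simp
  ultimately have "Group_Action.orbit ((sym_group n)\<lparr>carrier := generate (sym_group n) {g}\<rparr>) (\<lambda>\<sigma>. \<sigma>) x
      = Orbits.orbit g x" for x
    by (auto simp: Group_Action.orbit_def)
  then show ?thesis
    by (auto simp: cyclic_orbits_def Group_Action.orbits_def)
qed

theorem theorem1:
  fixes k n :: nat and g :: "nat \<Rightarrow> nat" and \<chi> :: "(nat \<Rightarrow> nat) \<Rightarrow> complex"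
  assumes "k \<ge> 1" and "n \<ge> k"
    and "g \<in> carrier (sym_group n)"
    and "card (cyclic_orbits n g) = k"
    and "irreducible_character (sym_group n) \<chi>"
  shows "cmod (\<chi> g) \<le> fact k"
proof -
  let ?G = "sym_group n" and ?X = "{1..n}"
  obtain d \<rho> where irr: "irreducible_representation ?G d \<rho>"
    and \<chi>: "\<And>x. x permutes ?X \<Longrightarrow> \<chi> x = mat_trace (\<rho> x)"
    using assms(5) by (auto simp: irreducible_character_def sym_group_carrier)
  have \<rho>: "representation ?G d \<rho>"
    using irr by (simp add: irreducible_representation_def)
  have carrier: "carrier ?G = {p. p permutes ?X}"
    by (auto simp: sym_group_carrier)
  have fin: "finite (carrier ?G)"
    unfolding carrier by (simp add: finite_permutations)
  have "cmod (\<chi> g) \<le> fact (card (Orbits.orbit g ` ?X))"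
  proof (rule class_function_bound)
    show "g permutes ?X" using assms(3) by (simp add: sym_group_carrier)
    show "\<chi> (x \<circ> y) = \<chi> (y \<circ> x)" if "x permutes ?X" "y permutes ?X" for x y
      using mat_trace_representation_commute[OF \<rho>, of x y] that
      by (simp add: \<chi> permutes_compose sym_group_carrier sym_group_mult)
    have "(\<Sum>x\<in>carrier ?G. \<chi> x * \<chi> (inv' x))
        = (\<Sum>x\<in>carrier ?G. mat_trace (\<rho> x) * mat_trace (\<rho> (inv\<^bsub>?G\<^esub> x)))"
      by (intro sum.cong refl) (simp add: \<chi> sym_group_carrier permutes_inv)
    also have "\<dots> = of_nat (card (carrier ?G))"
      by (rule character_norm[OF irr fin])
    also have "card (carrier ?G) = fact (card ?X)"
      unfolding carrier by (intro card_permutations) auto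
    finally show "(\<Sum>x | x permutes ?X. \<chi> x * \<chi> (inv' x)) = fact (card ?X)"
      unfolding carrier by simp
    fix c :: "nat \<Rightarrow> nat"
    \<comment> \<open>A Young subgroup: the permutations preserving the colour classes of
      \<open>c\<close>. Averaging \<open>\<rho>\<close> over it yields the integrality
      hypothesis.\<close>
    let ?H = "{x. x permutes ?X \<and> (\<forall>i\<in>?X. c (x i) = c i)}"
    have "subgroup ?H ?G"
    proof (rule group.subgroupI[OF sym_group_is_group])
      show "?H \<subseteq> carrier ?G" by (auto simp: sym_group_carrier)
      show "?H \<noteq> {}" using permutes_id by fastforce
      show "inv\<^bsub>?G\<^esub> x \<in> ?H" if x: "x \<in> ?H" for x
      proof -
        have px: "x permutes ?X" using x by simp
        have "c (inv' x i) = c i" if "i \<in> ?X" for i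
        proof -
          have "inv' x i \<in> ?X" using permutes_in_image[OF permutes_inv[OF px]] that by simp
          then have "c (x (inv' x i)) = c (inv' x i)" using x by blast
          then show ?thesis using permutes_inverses(1)[OF px] by simp
        qed
        then show ?thesis
          using px permutes_inv[OF px] by (simp add: sym_group_carrier)
      qed
      show "x \<otimes>\<^bsub>?G\<^esub> y \<in> ?H" if x: "x \<in> ?H" and y: "y \<in> ?H" for x y
      proof -
        have "c (x (y i)) = c i" if i: "i \<in> ?X" for i
        proof -
          have "y i \<in> ?X"
            using permutes_in_image[of y ?X i] y i by blast
          then have "c (x (y i)) = c (y i)" using x by blast
          also have "\<dots> = c i" using y i by blast
          finally show ?thesis .
        qed
        then show ?thesis
          using x y by (simp add: sym_group_mult permutes_compose)
      qed
    qed
    moreover have "finite ?H"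
      by (rule finite_subset[OF _ fin]) (auto simp: sym_group_carrier)
    moreover have "(\<Sum>x\<in>?H. \<chi> x) = (\<Sum>x\<in>?H. mat_trace (\<rho> x))"
      by (intro sum.cong refl) (simp add: \<chi>)
    ultimately show "\<exists>z::int. (\<Sum>x\<in>?H. \<chi> x) = of_nat (card ?H) * of_int z"
      using sum_mat_trace_subgroup[OF \<rho>] by simp
  qed simp
  then show ?thesis
    using assms(3,4) by (simp add: cyclic_orbits_eq)
qed

end
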